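(* For $k\in\mathbb{N}\setminus\{0\}$ define \[ \mathcal{C}_{\rm B}(k):=\sup\left\{\frac{\lambda(\Omega)}{\big(h(\Omega)\big)^2} : \Omega\subseteq\mathbb{R}^2\ \text{open, multiply connected of order } k,\ \text{with } r_\Omega<+\infty\right\}. \] Then the function $k\mapsto\mathcal{C}_{\rm B}(k)$ is monotone non-decreasing. Moreover, for every $0<\alpha<1$, we have \[ \lim_{k\to\infty}\frac{\mathcal{C}_{\rm B}(k)}{k^\alpha}=+\infty . \]
   Context: For an open set $\Omega\subseteq\mathbb{R}^2$, \[ \lambda(\Omega)=\inf_{u\in C^\infty_0(\Omega)\setminus\{0\}}\frac{\|\nabla u\|_{L^2(\Omega)}^2}{\|u\|_{L^2(\Omega)}^2},\qquad h(\Omega)=\inf\left\{\frac{\mathcal{H}^{1}(\partial E)}{|E|} : E\Subset\Omega \text{ has a smooth boundary}\right\}, \] where in the Cheeger constant $h(\Omega)$ the set $E$ ranges over nonempty open sets compactly contained in $\Omega$ with smooth boundary, $\mathcal{H}^1$ is the one-dimensional Hausdorff measure and $|\cdot|$ is Lebesgue measure. The inradius is $r_\Omega=\sup\{r>0 : \text{there exists a disk } B_r(x_0)\subseteq\Omega\}$. Let $(\mathbb{R}^2)^*$ be the one-point compactification of $\mathbb{R}^2$. An open connected set $\Omega\subseteq\mathbb{R}^2$ is multiply connected of order $k$ if its complement in $(\mathbb{R}^2)^*$ has exactly $k$ connected components. *)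

theory Defs
  imports "HOL-Analysis.Analysis"
begin

primrec Ck_on :: "nat \<Rightarrow> 'a::euclidean_space set \<Rightarrow> ('a \<Rightarrow> real) \<Rightarrow> bool" where
  "Ck_on 0 S f \<longleftrightarrow> continuous_on S f"
| "Ck_on (Suc k) S f \<longleftrightarrow> (\<forall>x\<in>S. f differentiable (at x)) \<and>
     (\<forall>b\<in>Basis. Ck_on k S (\<lambda>x. frechet_derivative f (at x) b))"

definition smooth_on :: "'a::euclidean_space set \<Rightarrow> ('a \<Rightarrow> real) \<Rightarrow> bool" where
  "smooth_on S f \<longleftrightarrow> open S \<and> (\<forall>k. Ck_on k S f)"

definition gradient :: "('a::euclidean_space \<Rightarrow> real) \<Rightarrow> 'a \<Rightarrow> 'a" where
  "gradient f x = (\<Sum>b\<in>Basis. frechet_derivative f (at x) b *\<^sub>R b)"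

lemma GDERIV_gradient:
  fixes f :: "'a::euclidean_space \<Rightarrow> real"
  assumes "f differentiable (at x)"
  shows "GDERIV f x :> gradient f x"
proof -
  have D: "(f has_derivative frechet_derivative f (at x)) (at x)"
    using assms by (simp add: frechet_derivative_works)
  then interpret linear "frechet_derivative f (at x)"
    by (rule has_derivative_linear)
  have "frechet_derivative f (at x) h = h \<bullet> gradient f x" for h
  proof -
    have "frechet_derivative f (at x) h
        = frechet_derivative f (at x) (\<Sum>b\<in>Basis. (h \<bullet> b) *\<^sub>R b)"
      by (simp add: euclidean_representation)
    also have "\<dots> = h \<bullet> gradient f x"
      by (simp add: sum scale gradient_def inner_sum_right mult.commute)
    finally show ?thesis .
  qed
  then have "frechet_derivative f (at x) = (\<lambda>h. h \<bullet> gradient f x)"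
    by blast
  with D show ?thesis
    by (simp add: gderiv_def)
qed

text \<open>Elements of \<open>C\<^sub>0\<^sup>\<infinity>(\<Omega>)\<close> are represented by their extension by zero to the whole space.\<close>

definition test_functions :: "'a::euclidean_space set \<Rightarrow> ('a \<Rightarrow> real) set" where
  "test_functions \<Omega> = {u. smooth_on UNIV u \<and>
     compact (closure {x. u x \<noteq> 0}) \<and> closure {x. u x \<noteq> 0} \<subseteq> \<Omega>}"

definition L2_norm_squared :: "'a::euclidean_space set \<Rightarrow> ('a \<Rightarrow> 'b::real_normed_vector) \<Rightarrow> ennreal" where
  "L2_norm_squared \<Omega> f = (\<integral>\<^sup>+x\<in>\<Omega>. ennreal ((norm (f x))\<^sup>2) \<partial>lborel)"

definition dirichlet_eigenvalue :: "(real^2) set \<Rightarrow> ennreal" where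
  "dirichlet_eigenvalue \<Omega> =
     (INF u \<in> test_functions \<Omega> - {\<lambda>x. 0}. L2_norm_squared \<Omega> (gradient u) / L2_norm_squared \<Omega> u)"

text \<open>Hausdorff measure is normalised so that it agrees with length: in dimension one the constant
  in front of the diameters is 1. Covering sets are required to be bounded because
  \<^const>\<open>diameter\<close> is unspecified on unbounded sets.\<close>

definition hausdorff1_pre :: "real \<Rightarrow> 'a::metric_space set \<Rightarrow> ennreal" where
  "hausdorff1_pre \<delta> A =
     (INF U \<in> {U :: nat \<Rightarrow> 'a set. A \<subseteq> (\<Union>n. U n) \<and> (\<forall>n. bounded (U n) \<and> diameter (U n) \<le> \<delta>)}.
        \<Sum>n. ennreal (diameter (U n)))"

definition hausdorff1 :: "'a::metric_space set \<Rightarrow> ennreal" where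
  "hausdorff1 A = (SUP \<delta> \<in> {0<..}. hausdorff1_pre \<delta> A)"

text \<open>Near each boundary point, \<open>E\<close> is a strict sublevel set of a smooth function without critical
  points; by the implicit function theorem this is the same as being locally the region on one side
  of a smooth graph.\<close>

definition smooth_boundary :: "'a::euclidean_space set \<Rightarrow> bool" where
  "smooth_boundary E \<longleftrightarrow> (\<forall>p\<in>frontier E. \<exists>r>0. \<exists>\<phi>. smooth_on (ball p r) \<phi> \<and>
     (\<forall>x\<in>ball p r. gradient \<phi> x \<noteq> 0) \<and> E \<inter> ball p r = {x \<in> ball p r. \<phi> x < 0})"

definition cheeger_constant :: "(real^2) set \<Rightarrow> ennreal" where
  "cheeger_constant \<Omega> =
     (INF E \<in> {E. open E \<and> E \<noteq> {} \<and> compact (closure E) \<and> closure E \<subseteq> \<Omega> \<and> smooth_boundary E}.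
        hausdorff1 (frontier E) / emeasure lborel E)"

definition inradius :: "(real^2) set \<Rightarrow> ennreal" where
  "inradius \<Omega> = (SUP r \<in> {r. 0 < r \<and> (\<exists>x. ball x r \<subseteq> \<Omega>)}. ennreal r)"

text \<open>In \<^const>\<open>Alexandroff_compactification\<close> the point at infinity is \<^const>\<open>None\<close>. The empty set,
  which \<^const>\<open>connected\<close> admits, is excluded.\<close>

definition multiply_connected :: "nat \<Rightarrow> (real^2) set \<Rightarrow> bool" where
  "multiply_connected k \<Omega> \<longleftrightarrow> open \<Omega> \<and> connected \<Omega> \<and> \<Omega> \<noteq> {} \<and>
     (let X = Alexandroff_compactification euclidean;
          K = connected_components_of (subtopology X (topspace X - Some ` \<Omega>))
      in finite K \<and> card K = k)"

text \<open>All quantities are extended non-negative reals, so the supremum is meaningful whether or not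
  it is finite.\<close>

definition C_B :: "nat \<Rightarrow> ennreal" where
  "C_B k = (SUP \<Omega> \<in> {\<Omega>. open \<Omega> \<and> multiply_connected k \<Omega> \<and> inradius \<Omega> < \<infinity>}.
     dirichlet_eigenvalue \<Omega> / (cheeger_constant \<Omega>)\<^sup>2)"

end

theory Submission
  imports Defs "HOL-Real_Asymp.Real_Asymp"
begin

text \<open>
  Deleting a point \<open>p\<close> from \<open>\<Omega>\<close> raises the order by one and cannot decrease \<open>\<lambda>\<close>; if \<open>p\<close> lies
  outside the closure of a competitor \<open>E\<close> for \<open>h(\<Omega>)\<close>, then \<open>E\<close> remains a competitor. Optimising over
  \<open>E\<close> gives monotonicity.

  For the growth rate, remove from the disc of radius \<open>n + 1\<close> the discs of radius \<open>1 / (8 n)\<close> centred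
  at the integer points of norm at most \<open>n\<close>. The order is \<open>O(n\<^sup>2)\<close>. The holes have total perimeter
  \<open>O(n)\<close> and negligible area, so \<open>h = O(1 / n)\<close>. In the plane even small holes have large capacity:
  integrating \<open>div (u\<^sup>2 X) = 0\<close> for a field \<open>X\<close> with \<open>div X - |X|\<^sup>2 \<ge> c / log n\<close> around each hole gives
  \<open>\<lambda> \<ge> c' / log n\<close>. Hence \<open>\<lambda> / h\<^sup>2\<close> is at least of order \<open>k / log k\<close>.
\<close>

section \<open>Connectivity of complements\<close>

text \<open>Scales: about n^2 holes of radius of order 1/n have total perimeter of order n, like the
  outer circle. Shrinking the holes costs only a logarithm in \<lambda>; that logarithm confines the
  argument to \<alpha> < 1. Origin of the field: if G > 0 is harmonic, then X = - grad G / G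
  satisfies div X = |X|^2 exactly, so there is nothing to gain until X is cut off. A factor \<phi>
  that decreases with the distance adds the positive term - grad \<phi> . grad G / G. With G = 1 +
  log (|x - z| / \<epsilon>), which is at most 1 + log (4 / \<epsilon>) within distance 4, the gain
  is of order 1 / log n. Near the outer circle holes may be missing. Test functions vanish beyond
  that circle, so lattice discs outside it serve as further holes. The order of the perforated disc
  is only bounded from above, and monotonicity carries the estimate to every large k. In the proof
  of monotonicity the deleted point depends on E, so the Cheeger constants before and after the
  deletion are never compared; everything is done with the quotient of one fixed E.\<close>

lemma card_connected_components_of_le:
  assumes "finite F" "topspace X \<subseteq> \<Union>F" "\<And>C. C \<in> F \<Longrightarrow> connectedin X C"
  shows "finite (connected_components_of X) \<and> card (connected_components_of X) \<le> card F"
proof -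
  \<comment> \<open>Distinct components are disjoint, so choosing a nonempty member of
    \<open>F\<close> inside each of them is injective.\<close>
  have "\<exists>C\<in>F. C \<noteq> {} \<and> C \<subseteq> K" if K: "K \<in> connected_components_of X" for K
  proof -
    obtain x where x: "x \<in> K" "x \<in> topspace X"
      using nonempty_connected_components_of[OF K] connected_components_of_subset[OF K] by blast
    then obtain C where "C \<in> F" "x \<in> C"
      using assms(2) by blast
    moreover have "C \<subseteq> K"
      using connected_components_of_maximal[OF K assms(3)[OF \<open>C \<in> F\<close>]] x \<open>x \<in> C\<close>
      by (auto simp: disjnt_def)
    ultimately show ?thesis by blast
  qed
  then obtain g where g: "\<And>K. K \<in> connected_components_of X \<Longrightarrow> g K \<in> F \<and> g K \<noteq> {} \<and> g K \<subseteq> K"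
    by metis
  have "inj_on g (connected_components_of X)"
  proof (rule inj_onI)
    fix K L assume KL: "K \<in> connected_components_of X" "L \<in> connected_components_of X" "g K = g L"
    then have "K \<inter> L \<noteq> {}" using g[of K] g[of L] by auto
    then show "K = L" using connected_components_of_overlap[OF KL(1,2)] by blast
  qed
  moreover have "g ` connected_components_of X \<subseteq> F" using g by auto
  ultimately show ?thesis
    using card_inj_on_le[OF _ _ assms(1)] inj_on_finite[OF _ _ assms(1)] by blast
qed

text \<open>A connected set cannot contain a clopen point together with anything else, so the new
  point is a component by itself and the old components survive unchanged.\<close>

lemma connected_components_of_insert_isolated:
  assumes "p \<notin> K" "openin (subtopology X (insert p K)) {p}" "closedin (subtopology X (insert p K)) {p}"
  shows "connected_components_of (subtopology X (insert p K)) =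
         insert {p} (connected_components_of (subtopology X K))"
proof -
  let ?Y = "subtopology X (insert p K)"
  let ?Z = "subtopology X K"
  have pX: "p \<in> topspace X" using openin_subset[OF assms(2)] by auto
  have sep: "S \<subseteq> {p} \<or> S \<subseteq> K" if "connectedin ?Y S" for S
    using connectedin_clopen_cases[OF that assms(3,2)] connectedin_subset_topspace[OF that]
    by (auto simp: disjnt_def)
  have con: "connectedin ?Y S \<longleftrightarrow> connectedin ?Z S" if "S \<subseteq> K" for S
    using that by (auto simp: connectedin_subtopology)
  have cp: "connected_component_of_set ?Y p = {p}"
  proof (rule connected_component_of_unique)
    show "connectedin ?Y {p}" using pX by (simp add: connectedin_sing)
    show "\<And>C'. p \<in> C' \<and> connectedin ?Y C' \<Longrightarrow> C' \<subseteq> {p}" using sep assms(1) by blast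
  qed simp
  have cx: "connected_component_of_set ?Y x = connected_component_of_set ?Z x" if "x \<in> K" for x
  proof -
    have "connected_component_of ?Y x y = connected_component_of ?Z x y" for y
      unfolding connected_component_of_def
      using sep con that assms(1) by (metis connectedin_subtopology singletonD subset_iff)
    then show ?thesis by (rule arg_cong[where f=Collect, OF ext])
  qed
  have "topspace ?Y = insert p (topspace ?Z)" using pX by auto
  then show ?thesis
    unfolding connected_components_of_def using cp cx by auto
qed

text \<open>\<Omega> is open in the compactification and meets the new complement in
  \<open>Some p\<close> only, so this point is isolated there. Deleting a point does not disconnect
  an open connected set in the plane.\<close>

lemma multiply_connected_delete:
  assumes "multiply_connected k \<Omega>" "p \<in> \<Omega>"
  shows "multiply_connected (Suc k) (\<Omega> - {p})"
proof -
  let ?X = "Alexandroff_compactification (euclidean :: (real^2) topology)"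
  let ?K = "topspace ?X - Some ` \<Omega>"
  have \<Omega>: "open \<Omega>" "connected \<Omega>" "finite (connected_components_of (subtopology ?X ?K))"
      "card (connected_components_of (subtopology ?X ?K)) = k"
    using assms(1) by (auto simp: multiply_connected_def Let_def)
  have eq: "topspace ?X - Some ` (\<Omega> - {p}) = insert (Some p) ?K"
    using assms(2) by auto
  have "openin ?X (Some ` \<Omega>)" using \<Omega>(1) by simp
  then have "openin (subtopology ?X (insert (Some p) ?K)) (insert (Some p) ?K \<inter> Some ` \<Omega>)"
    by (rule openin_subtopology_Int2)
  moreover have "insert (Some p) ?K \<inter> Some ` \<Omega> = {Some p}" using assms(2) by auto
  ultimately have o: "openin (subtopology ?X (insert (Some p) ?K)) {Some p}" by simp
  have "closedin ?X (Some ` {p})"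
    by (simp only: closedin_Alexandroff_compactification_image_Some) simp
  then have c: "closedin (subtopology ?X (insert (Some p) ?K)) {Some p}"
    using closedin_subset_topspace by (metis image_insert image_empty insert_subset empty_subsetI insertI1)
  have pK: "Some p \<notin> ?K" using assms(2) by auto
  note comp = connected_components_of_insert_isolated[OF pK o c]
  have "{Some p} \<notin> connected_components_of (subtopology ?X ?K)"
    using connected_components_of_subset[of "{Some p}" "subtopology ?X ?K"] pK by auto
  moreover have "\<Omega> - {p} \<noteq> {}"
    using \<Omega>(1) assms(2) by (metis Diff_eq_empty_iff empty_iff insertE not_open_singleton subset_singletonD)
  moreover have "connected (\<Omega> - {p})"
    by (rule connected_open_delete[OF \<Omega>(1,2)]) simp
  ultimately show ?thesis
    unfolding multiply_connected_def Let_def eq comp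
    using card_insert_disjoint[OF \<Omega>(3)] \<Omega>(3,4) open_delete[OF \<Omega>(1)] finite.insertI by metis
qed

section \<open>Order of a perforated disc\<close>

text \<open>The set is exhausted by the sets \<open>S - ball a s\<close> with r < s \<le> d. Each is
  connected, and all of them contain a point at distance d from \<open>a\<close>.\<close>

lemma connected_diff_cball:
  fixes S :: "'a::euclidean_space set"
  assumes "open S" "connected S" "cball a r \<subseteq> S" "2 \<le> DIM('a)"
  shows "connected (S - cball a r)"
proof (cases "r \<ge> 0")
  case False
  then show ?thesis using assms by simp
next
  case True
  obtain d where d: "d > r" "cball a d \<subseteq> S"
  proof -
    have "compact (cball a r)" by simp
    then obtain e where e: "e > 0" "(\<Union>x\<in>cball a r. cball x e) \<subseteq> S"
      using compact_subset_open_imp_cball_epsilon_subset[OF _ assms(1,3)] by auto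
    have "cball a (r + e) \<subseteq> (\<Union>x\<in>cball a r. cball x e)"
    proof
      fix y assume y: "y \<in> cball a (r + e)"
      show "y \<in> (\<Union>x\<in>cball a r. cball x e)"
      proof (cases "dist a y \<le> r")
        case True
        then show ?thesis using \<open>e > 0\<close> by (auto intro!: bexI[of _ y])
      next
        case False
        \<comment> \<open>The point \<open>x\<close> below is the radial projection of
          \<open>y\<close> to the sphere of radius r.\<close>
        define t where "t = r / dist a y"
        have t: "0 \<le> t" "t \<le> 1" "t * dist a y = r" using False True by (auto simp: t_def divide_simps)
        define x where "x = a + t *\<^sub>R (y - a)"
        have "dist a x = r" using t by (simp add: x_def dist_norm norm_minus_commute)
        moreover have "dist x y = (1 - t) * dist a y"
        proof -
          have "x - y = (1 - t) *\<^sub>R (a - y)" by (simp add: x_def algebra_simps)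
          then show ?thesis using t by (simp add: dist_norm)
        qed
        then have "dist x y \<le> e" using y t by (simp add: algebra_simps)
        ultimately show ?thesis by (auto intro!: bexI[of _ x])
      qed
    qed
    then show thesis using that[of "r + e"] e by auto
  qed
  have eq: "S - cball a r = (\<Union>s\<in>{r<..d}. S - ball a s)"
  proof -
    have "\<exists>s\<in>{r<..d}. dist a x \<ge> s" if "dist a x > r" for x
      using that d by (intro bexI[of _ "min d (dist a x)"]) auto
    then have "x \<in> S - cball a r \<longleftrightarrow> (\<exists>s\<in>{r<..d}. x \<in> S - ball a s)" for x
      by (force simp: not_less not_le)
    then show ?thesis by blast
  qed
  obtain x where x: "x \<in> S - ball a d"
  proof -
    obtain b :: 'a where b: "b \<in> Basis" using nonempty_Basis by blast
    have "a + d *\<^sub>R b \<in> sphere a d" using b d True by (simp add: dist_norm)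
    then have "a + d *\<^sub>R b \<in> S - ball a d" using d by auto
    then show thesis by (rule that)
  qed
  show ?thesis unfolding eq
  proof (rule connected_Union)
    show "connected s" if "s \<in> (\<lambda>s. S - ball a s) ` {r<..d}" for s
    proof -
      from that obtain t where "t \<in> {r<..d}" and s: "s = S - ball a t" by (rule imageE)
      then have t: "r < t" "t \<le> d" by auto
      then show ?thesis using connected_diff_ball[OF assms(2) _ assms(4), of a t] d s by force
    qed
    have "x \<in> (\<Inter>s\<in>{r<..d}. S - ball a s)" using x by auto
    then show "\<Inter> ((\<lambda>s. S - ball a s) ` {r<..d}) \<noteq> {}" by blast
  qed
qed

lemma connected_diff_Union_cball:
  fixes S :: "'a::euclidean_space set"
  assumes "open S" "connected S" "2 \<le> DIM('a)" "finite I"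
    and "\<And>i. i \<in> I \<Longrightarrow> cball (a i) r \<subseteq> S"
    and "\<And>i j. i \<in> I \<Longrightarrow> j \<in> I \<Longrightarrow> i \<noteq> j \<Longrightarrow> cball (a i) r \<inter> cball (a j) r = {}"
  shows "connected (S - (\<Union>i\<in>I. cball (a i) r))"
  using assms(4-6)
proof (induction I)
  case empty
  then show ?case using assms by simp
next
  case (insert i I)
  have "open (S - (\<Union>i\<in>I. cball (a i) r))"
    using assms(1) insert.hyps by (intro open_Diff closed_UN) auto
  moreover have "connected (S - (\<Union>i\<in>I. cball (a i) r))"
    using insert by (simp add: insert.IH)
  moreover have "cball (a i) r \<subseteq> S - (\<Union>i\<in>I. cball (a i) r)"
  proof -
    have "cball (a i) r \<inter> cball (a j) r = {}" if "j \<in> I" for j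
      using insert.prems(2)[of i j] insert.hyps(2) that by auto
    then show ?thesis using insert.prems(1)[of i] by auto
  qed
  ultimately have "connected (S - (\<Union>i\<in>I. cball (a i) r) - cball (a i) r)"
    using connected_diff_cball assms(3) by blast
  moreover have "S - (\<Union>i\<in>I. cball (a i) r) - cball (a i) r = S - (\<Union>i\<in>insert i I. cball (a i) r)"
    by auto
  ultimately show ?case by simp
qed

lemma connectedin_Alexandroff_outside_ball:
  "connectedin (Alexandroff_compactification euclidean)
     (insert None (Some ` (- ball (0::'a::euclidean_space) r)))"
  if "2 \<le> DIM('a)"
proof (rule connectedin_intermediate_closure_of)
  let ?X = "Alexandroff_compactification (euclidean :: 'a topology)"
  let ?S = "- ball (0::'a) r"
  have con: "connected ?S"
  proof (cases "r \<ge> 0")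
    case True
    have "connected (UNIV - ball (0::'a) r)"
      by (rule connected_diff_ball) (use that in auto)
    then show ?thesis by (simp add: Compl_eq_Diff_UNIV)
  next
    case False
    then have "?S = UNIV" by (simp add: ball_empty)
    then show ?thesis by (simp add: connected_UNIV)
  qed
  then show "connectedin ?X (Some ` ?S)"
    by (intro connectedin_continuous_map_image[OF continuous_map_Some]) simp
  show "Some ` ?S \<subseteq> insert None (Some ` ?S)" by auto
  show "insert None (Some ` ?S) \<subseteq> ?X closure_of (Some ` ?S)"
  proof -
    have "Some ` ?S \<subseteq> ?X closure_of (Some ` ?S)"
      by (rule closure_of_subset) auto
    moreover have "None \<in> ?X closure_of (Some ` ?S)"
      unfolding in_closure_of
    proof (intro conjI allI impI)
      fix T assume T: "None \<in> T \<and> openin ?X T"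
      then obtain C where C: "compactin euclidean C" "T = insert None (Some ` (topspace euclidean - C))"
        unfolding openin_Alexandroff_compactification by auto
      then have "bounded (C \<union> ball 0 r)" by (auto intro: compact_imp_bounded)
      then have "C \<union> ball 0 r \<noteq> UNIV" using not_bounded_UNIV by metis
      then obtain x where "x \<notin> C" "x \<in> ?S" by blast
      then have "Some x \<in> Some ` ?S \<and> Some x \<in> T" using C(2) by simp
      then show "\<exists>y. y \<in> Some ` ?S \<and> y \<in> T" by blast
    qed simp
    ultimately show ?thesis by auto
  qed
qed

text \<open>The complement is the union of the closed discs and of the exterior with infinity, all
  connected. An upper bound on the order is enough, because \<open>mono_C_B\<close> passes from
  order j to every larger order.\<close>

lemma multiply_connected_perforated_ball:
  fixes a :: "'i \<Rightarrow> real^2"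
  assumes "0 < R" "finite I"
    and sub: "\<And>i. i \<in> I \<Longrightarrow> cball (a i) r \<subseteq> ball 0 R"
    and disj: "\<And>i j. i \<in> I \<Longrightarrow> j \<in> I \<Longrightarrow> i \<noteq> j \<Longrightarrow> cball (a i) r \<inter> cball (a j) r = {}"
    and ne: "ball 0 R - (\<Union>i\<in>I. cball (a i) r) \<noteq> {}"
  shows "\<exists>j. j \<le> card I + 1 \<and> multiply_connected j (ball 0 R - (\<Union>i\<in>I. cball (a i) r))"
proof -
  let ?X = "Alexandroff_compactification (euclidean :: (real^2) topology)"
  let ?W = "ball 0 R - (\<Union>i\<in>I. cball (a i) r)"
  let ?K = "topspace ?X - Some ` ?W"
  let ?C = "connected_components_of (subtopology ?X ?K)"
  define F where "F = insert (insert None (Some ` (- ball (0::real^2) R))) ((\<lambda>i. Some ` cball (a i) r) ` I)"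
  have "finite ?C \<and> card ?C \<le> card F"
  proof (rule card_connected_components_of_le)
    show "finite F" using assms(2) by (simp add: F_def)
    show "topspace (subtopology ?X ?K) \<subseteq> \<Union>F"
    proof
      fix y assume y: "y \<in> topspace (subtopology ?X ?K)"
      show "y \<in> \<Union>F"
      proof (cases y)
        case None
        then show ?thesis by (simp add: F_def)
      next
        case (Some x)
        with y have "x \<notin> ball 0 R \<or> (\<exists>i\<in>I. x \<in> cball (a i) r)" by auto
        then have "x \<in> - ball 0 R \<or> (\<exists>i\<in>I. x \<in> cball (a i) r)" by blast
        then show ?thesis unfolding F_def Some by blast
      qed
    qed
    show "connectedin (subtopology ?X ?K) C" if "C \<in> F" for C
    proof -
      have "C \<subseteq> ?K" using that unfolding F_def by auto
      moreover have "connectedin ?X C"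
      proof (cases "C = insert None (Some ` (- ball (0::real^2) R))")
        case True
        then show ?thesis using connectedin_Alexandroff_outside_ball[where 'a="real^2"] by simp
      next
        case False
        then obtain i where "C = Some ` cball (a i) r" using \<open>C \<in> F\<close> by (auto simp: F_def)
        then show ?thesis by (auto intro!: connectedin_continuous_map_image[OF continuous_map_Some])
      qed
      ultimately show ?thesis by (simp add: connectedin_subtopology)
    qed
  qed
  moreover have "card F \<le> card I + 1"
    unfolding F_def by (rule order_trans[OF card_insert_le_m1[of "card I + 1"]])
      (use card_image_le[OF assms(2)] in auto)
  moreover have "open ?W" using assms(2) by (intro open_Diff closed_UN) auto
  moreover have "connected ?W"
    by (rule connected_diff_Union_cball) (use assms in auto)
  ultimately have "multiply_connected (card ?C) ?W" "card ?C \<le> card I + 1"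
    using ne unfolding multiply_connected_def Let_def by simp_all
  then show ?thesis by blast
qed

section \<open>Monotonicity\<close>

lemma test_functions_mono: "U \<subseteq> V \<Longrightarrow> test_functions U \<subseteq> test_functions V"
  by (auto simp: test_functions_def)

lemma L2_norm_squared_extend:
  assumes "U \<subseteq> V" "\<And>x. x \<in> V - U \<Longrightarrow> f x = 0"
  shows "L2_norm_squared U f = L2_norm_squared V f"
  unfolding L2_norm_squared_def
  by (rule nn_integral_cong) (use assms in \<open>auto simp: indicator_def\<close>)

lemma gradient_eq_0_outside_support:
  assumes "x \<notin> closure {x. u x \<noteq> 0}"
  shows "gradient u x = 0"
proof -
  have "((\<lambda>_. 0) has_derivative (\<lambda>_. 0)) (at x)" by simp
  then have "(u has_derivative (\<lambda>_. 0)) (at x)"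
  proof (rule has_derivative_transform_within_open)
    show "open (- closure {x. u x \<noteq> 0})" by (rule open_Compl) (rule closed_closure)
    show "\<And>y. y \<in> - closure {x. u x \<noteq> 0} \<Longrightarrow> 0 = u y"
      using closure_subset[of "{x. u x \<noteq> 0}"] by auto
  qed (use assms in simp)
  then show ?thesis
    by (simp add: gradient_def frechet_derivative_at[symmetric])
qed

lemma dirichlet_eigenvalue_antimono:
  assumes "U \<subseteq> V"
  shows "dirichlet_eigenvalue V \<le> dirichlet_eigenvalue U"
  unfolding dirichlet_eigenvalue_def
proof (rule INF_mono)
  fix u assume u: "u \<in> test_functions U - {\<lambda>x. 0}"
  then have s: "closure {x. u x \<noteq> 0} \<subseteq> U" by (auto simp: test_functions_def)
  have "u x = 0" if "x \<notin> U" for x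
    using s closure_subset[of "{x. u x \<noteq> 0}"] that by auto
  then have "L2_norm_squared U u = L2_norm_squared V u"
    by (intro L2_norm_squared_extend[OF assms]) auto
  moreover have "L2_norm_squared U (gradient u) = L2_norm_squared V (gradient u)"
    by (intro L2_norm_squared_extend[OF assms] gradient_eq_0_outside_support) (use s in auto)
  ultimately show "\<exists>v\<in>test_functions V - {\<lambda>x. 0}.
      L2_norm_squared V (gradient v) / L2_norm_squared V v
      \<le> L2_norm_squared U (gradient u) / L2_norm_squared U u"
    using u test_functions_mono[OF assms] by auto
qed

lemma inradius_mono: "U \<subseteq> V \<Longrightarrow> inradius U \<le> inradius V"
  unfolding inradius_def by (rule SUP_subset_mono) auto

lemma cheeger_constant_le:
  assumes "open E" "E \<noteq> {}" "compact (closure E)" "closure E \<subseteq> \<Omega>" "smooth_boundary E"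
  shows "cheeger_constant \<Omega> \<le> hausdorff1 (frontier E) / emeasure lborel E"
  unfolding cheeger_constant_def using assms by (intro INF_lower) auto

lemma C_B_ge:
  assumes "multiply_connected k \<Omega>" "inradius \<Omega> < \<infinity>"
  shows "dirichlet_eigenvalue \<Omega> / (cheeger_constant \<Omega>)\<^sup>2 \<le> C_B k"
  unfolding C_B_def using assms by (intro SUP_upper) (auto simp: multiply_connected_def)

lemma ennreal_inverse_antimono: "a \<le> b \<Longrightarrow> inverse b \<le> inverse (a::ennreal)"
  unfolding less_eq_ennreal.rep_eq inverse_ennreal.rep_eq
  by (rule ereal_inverse_antimono) simp_all

text \<open>Inversion is continuous and antitone, so it turns the infimum into a supremum and the
  square into a supremum over pairs \<open>E\<close>, \<open>D\<close>. A mixed product is at most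
  the square of its larger factor, which the hypothesis bounds. The values 0 and infinity thus need
  no separate treatment.\<close>

lemma divide_INF_power2_ennreal:
  fixes c :: ennreal
  assumes "\<And>E. E \<in> S \<Longrightarrow> c / (f E)\<^sup>2 \<le> C"
  shows "c / (INF E\<in>S. f E)\<^sup>2 \<le> C"
proof (cases "S = {}")
  case True
  \<comment> \<open>The empty infimum is infinity, and a quotient by infinity is 0.\<close>
  then show ?thesis by (simp add: ennreal_divide_top power2_eq_square ennreal_top_mult)
next
  case False
  have "inverse (Inf (f ` S)) = (SUP x\<in>f ` S. inverse x)"
  proof (rule continuous_at_Inf_antimono)
    show "antimono (inverse :: ennreal \<Rightarrow> _)"
      by (intro antimonoI ennreal_inverse_antimono)
    have "continuous_on UNIV (inverse :: ennreal \<Rightarrow> _)"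
      by (intro continuous_on_inverse_ennreal continuous_on_id)
    then show "continuous (at_right (Inf (f ` S))) (inverse :: ennreal \<Rightarrow> _)"
      by (simp add: continuous_on_eq_continuous_at continuous_at_imp_continuous_at_within)
  qed (use False in auto)
  then have inv: "inverse (INF E\<in>S. f E) = (SUP E\<in>S. inverse (f E))"
    by (simp add: image_image)
  have *: "c * (inverse (f E) * inverse (f D)) \<le> C" if "E \<in> S" "D \<in> S" for E D
  proof -
    have le: "c * (inverse (f E) * inverse (f E)) \<le> C" if "E \<in> S" for E
      using assms[OF that]
      by (simp only: divide_ennreal_def ennreal_inverse_power power2_eq_square[of "inverse _"])
    show ?thesis
    proof (cases "inverse (f E) \<le> inverse (f D)")
      case True
      then have "c * (inverse (f E) * inverse (f D)) \<le> c * (inverse (f D) * inverse (f D))"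
        by (intro mult_mono) auto
      then show ?thesis using le[OF that(2)] by (rule order_trans)
    next
      case False
      then have "c * (inverse (f E) * inverse (f D)) \<le> c * (inverse (f E) * inverse (f E))"
        by (intro mult_mono) auto
      then show ?thesis using le[OF that(1)] by (rule order_trans)
    qed
  qed
  have "c / (INF E\<in>S. f E)\<^sup>2 = c * (SUP E\<in>S. inverse (f E)) * (SUP D\<in>S. inverse (f D))"
    by (simp only: divide_ennreal_def ennreal_inverse_power inv) (simp only: power2_eq_square mult.assoc)
  also have "\<dots> = (SUP D\<in>S. SUP E\<in>S. c * (inverse (f E) * inverse (f D)))"
    by (simp add: SUP_mult_left_ennreal SUP_mult_right_ennreal mult.assoc)
  also have "\<dots> \<le> C" using * by (intro SUP_least)
  finally show ?thesis .
qed

lemma C_B_le_Suc: "C_B k \<le> C_B (Suc k)"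
  unfolding C_B_def[of k]
proof (rule SUP_least)
  fix \<Omega> assume "\<Omega> \<in> {\<Omega>. open \<Omega> \<and> multiply_connected k \<Omega> \<and> inradius \<Omega> < \<infinity>}"
  then have \<Omega>: "open \<Omega>" "multiply_connected k \<Omega>" "inradius \<Omega> < \<infinity>" by auto
  show "dirichlet_eigenvalue \<Omega> / (cheeger_constant \<Omega>)\<^sup>2 \<le> C_B (Suc k)"
    unfolding cheeger_constant_def[of \<Omega>]
  proof (rule divide_INF_power2_ennreal)
    fix E assume "E \<in> {E. open E \<and> E \<noteq> {} \<and> compact (closure E) \<and> closure E \<subseteq> \<Omega> \<and> smooth_boundary E}"
    then have E: "open E" "E \<noteq> {}" "compact (closure E)" "closure E \<subseteq> \<Omega>" "smooth_boundary E" by auto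
    \<comment> \<open>Otherwise \<Omega> would be nonempty, open and closed, hence the whole plane,
      although it is bounded. This provides a point whose deletion leaves the competitor
      intact.\<close>
    have "closure E \<noteq> \<Omega>"
    proof
      assume "closure E = \<Omega>"
      then have "open \<Omega>" "closed \<Omega>" "bounded \<Omega>" "\<Omega> \<noteq> {}"
        using \<Omega> E by (auto simp: compact_imp_bounded compact_imp_closed)
      then show False using clopen[of \<Omega>] not_bounded_UNIV by auto
    qed
    then obtain p where p: "p \<in> \<Omega>" "p \<notin> closure E" using E(4) by auto
    \<comment> \<open>The numerator grows by domain monotonicity. The denominator shrinks because
      \<open>E\<close> is still admissible in \<open>\<Omega> - {p}\<close>.\<close>
    have "dirichlet_eigenvalue \<Omega> / (hausdorff1 (frontier E) / emeasure lborel E)\<^sup>2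
      \<le> dirichlet_eigenvalue (\<Omega> - {p}) / (cheeger_constant (\<Omega> - {p}))\<^sup>2"
      unfolding divide_ennreal_def[of "dirichlet_eigenvalue _"]
      by (intro mult_mono ennreal_inverse_antimono power_mono
           dirichlet_eigenvalue_antimono cheeger_constant_le) (use E p in auto)
    also have "\<dots> \<le> C_B (Suc k)"
      using order.strict_trans1[OF inradius_mono \<Omega>(3)]
      by (intro C_B_ge multiply_connected_delete \<Omega> p) auto
    finally show "dirichlet_eigenvalue \<Omega> / (hausdorff1 (frontier E) / emeasure lborel E)\<^sup>2
      \<le> C_B (Suc k)" .
  qed
qed

lemma mono_C_B: "mono C_B"
  using C_B_le_Suc by (rule mono_iff_le_Suc[THEN iffD2, OF allI])

section \<open>Hausdorff measure of circles\<close>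

lemma hausdorff1_le_finite_covers:
  assumes "\<And>\<delta>. \<delta> > 0 \<Longrightarrow> \<exists>(I::'i set) U. finite I \<and> A \<subseteq> (\<Union>i\<in>I. U i) \<and>
      (\<forall>i\<in>I. bounded (U i) \<and> diameter (U i) \<le> \<delta>) \<and> (\<Sum>i\<in>I. diameter (U i)) \<le> c"
  shows "hausdorff1 A \<le> ennreal c"
  unfolding hausdorff1_def
proof (rule SUP_least)
  fix \<delta> :: real assume "\<delta> \<in> {0<..}"
  then have "\<delta> > 0" by simp
  then obtain I :: "'i set" and U where U: "finite I" "A \<subseteq> (\<Union>i\<in>I. U i)"
      "\<forall>i\<in>I. bounded (U i) \<and> diameter (U i) \<le> \<delta>" "(\<Sum>i\<in>I. diameter (U i)) \<le> c"
    using assms by blast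
  obtain h where h: "bij_betw h {..<card I} I"
    using bij_betw_from_nat_into_finite[OF U(1)] by blast
  \<comment> \<open>The definition asks for a sequence of covering sets; the padding by empty sets
    has diameter 0.\<close>
  define V where "V n = (if n < card I then U (h n) else {})" for n
  have "A \<subseteq> (\<Union>n. V n)"
  proof
    fix x assume "x \<in> A"
    then obtain i where i: "i \<in> I" "x \<in> U i" using U(2) by blast
    then obtain n where "n < card I" "h n = i" using h by (metis bij_betw_iff_bijections lessThan_iff)
    then show "x \<in> (\<Union>n. V n)" using i by (auto simp: V_def intro!: exI[of _ n])
  qed
  moreover have hI: "h n \<in> I" if "n < card I" for n
    using that bij_betwE[OF h] by blast
  then have "bounded (V n) \<and> diameter (V n) \<le> \<delta>" for n
    using U(3) \<open>\<delta> > 0\<close> by (simp add: V_def)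
  ultimately have "hausdorff1_pre \<delta> A \<le> (\<Sum>n. ennreal (diameter (V n)))"
    unfolding hausdorff1_pre_def by (intro INF_lower) auto
  also have "\<dots> = (\<Sum>n<card I. ennreal (diameter (V n)))"
    by (rule suminf_finite) (auto simp: V_def)
  also have "\<dots> = (\<Sum>n<card I. ennreal (diameter (U (h n))))"
    by (simp add: V_def)
  also have "\<dots> = (\<Sum>i\<in>I. ennreal (diameter (U i)))"
    using sum.reindex_bij_betw[OF h, of "\<lambda>i. ennreal (diameter (U i))"] .
  also have "\<dots> = ennreal (\<Sum>i\<in>I. diameter (U i))"
    using U(3) by (intro sum_ennreal) (auto intro: diameter_ge_0)
  also have "\<dots> \<le> ennreal c" using U(4) by (rule ennreal_leI)
  finally show "hausdorff1_pre \<delta> A \<le> ennreal c" .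
qed

text \<open>Cut \<open>{0..l}\<close> into N equal pieces. The images of the pieces have diameters
  at most \<open>C j * l / N\<close>, with the same total for every N, so N is free to make each of
  them at most \<delta>. Covering all curves at once avoids subadditivity of
  \<open>hausdorff1\<close>.\<close>

lemma hausdorff1_UN_Lipschitz_image_le:
  fixes f :: "'j \<Rightarrow> real \<Rightarrow> 'a::real_normed_vector"
  assumes "finite J" "0 \<le> l" and C: "\<And>j. j \<in> J \<Longrightarrow> 0 \<le> C j"
    and lip: "\<And>j s t. j \<in> J \<Longrightarrow> dist (f j s) (f j t) \<le> C j * \<bar>s - t\<bar>"
    and A: "A \<subseteq> (\<Union>j\<in>J. f j ` {0..l})"
  shows "hausdorff1 A \<le> ennreal (l * (\<Sum>j\<in>J. C j))"
proof (rule hausdorff1_le_finite_covers)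
  fix \<delta> :: real assume "\<delta> > 0"
  \<comment> \<open>The summand 1 keeps N positive when the sum or l is 0.\<close>
  obtain N :: nat where N: "real N > (\<Sum>j\<in>J. C j) * l / \<delta> + 1"
    using reals_Archimedean2 by blast
  have S0: "0 \<le> (\<Sum>j\<in>J. C j)" using C by (rule sum_nonneg)
  then have N0: "real N > 0" using N \<open>\<delta> > 0\<close> \<open>0 \<le> l\<close>
    by (smt (verit) divide_nonneg_pos mult_nonneg_nonneg)
  define U where "U = (\<lambda>(j, i). f j ` {real i * l / real N .. real (Suc i) * l / real N})"
  have dist: "dist x y \<le> C j * l / real N" if xy: "j \<in> J" "x \<in> U (j, i)" "y \<in> U (j, i)" for j i x y
  proof -
    obtain s t where st: "x = f j s" "y = f j t"
       "s \<in> {real i * l / real N .. real (Suc i) * l / real N}"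
       "t \<in> {real i * l / real N .. real (Suc i) * l / real N}"
      using xy by (auto simp: U_def)
    have "real (Suc i) * l / real N = real i * l / real N + l / real N"
      by (simp add: distrib_right add_divide_distrib)
    then have "\<bar>s - t\<bar> \<le> l / real N" using st by auto
    then have "C j * \<bar>s - t\<bar> \<le> C j * (l / real N)" using C[OF xy(1)] by (rule mult_left_mono)
    then show ?thesis using lip[OF xy(1), of s t] st by simp
  qed
  have bd: "bounded (U (j, i))" if "j \<in> J" for j i
    using dist[OF that] by (meson bounded_two_points)
  have diam: "diameter (U (j, i)) \<le> C j * l / real N" if "j \<in> J" for j i
  proof (rule diameter_le)
    show "U (j, i) \<noteq> {} \<or> 0 \<le> C j * l / real N" using C[OF that] \<open>0 \<le> l\<close> by simp
  qed (use dist[OF that] in \<open>auto simp: dist_norm\<close>)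
  show "\<exists>(I::('j \<times> nat) set) U. finite I \<and> A \<subseteq> (\<Union>i\<in>I. U i) \<and>
      (\<forall>i\<in>I. bounded (U i) \<and> diameter (U i) \<le> \<delta>) \<and> (\<Sum>i\<in>I. diameter (U i)) \<le> l * (\<Sum>j\<in>J. C j)"
  proof (intro exI[of _ "J \<times> {..<N}"] exI[of _ U] conjI ballI)
    show "finite (J \<times> {..<N})" using assms(1) by simp
    show "A \<subseteq> (\<Union>i\<in>J \<times> {..<N}. U i)"
    proof
      fix x assume "x \<in> A"
      then obtain j t where jt: "j \<in> J" "t \<in> {0..l}" "x = f j t" using A by blast
      have "\<exists>i<N. t \<in> {real i * l / real N .. real (Suc i) * l / real N}"
      proof (cases "t = l")
        case True
        \<comment> \<open>At the right end point the floor used below would give the index N; the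
          last piece has index N - 1.\<close>
        then show ?thesis using N0 \<open>0 \<le> l\<close> 
          by (intro exI[of _ "N - 1"]) (auto simp: field_simps of_nat_diff)
      next
        case False
        then have l: "0 < l" "t < l" "0 \<le> t" using jt \<open>0 \<le> l\<close> by auto
        define q where "q = t * real N / l"
        have q: "0 \<le> q" "q < real N" "t = q * l / real N" using l N0 by (auto simp: q_def field_simps)
        define i where "i = nat \<lfloor>q\<rfloor>"
        have i: "real i \<le> q" "q \<le> real (Suc i)" using q(1) by (auto simp: i_def) linarith
        then have "i < N" using q(2) by linarith
        moreover have "real i * l / real N \<le> t" "t \<le> real (Suc i) * l / real N"
          unfolding q(3) using i l N0 by (auto intro!: divide_right_mono mult_right_mono)
        ultimately show ?thesis by auto
      qed
      then show "x \<in> (\<Union>i\<in>J \<times> {..<N}. U i)" using jt by (fastforce simp: U_def)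
    qed
    show "bounded (U p)" if "p \<in> J \<times> {..<N}" for p using bd that by auto
    show "diameter (U p) \<le> \<delta>" if "p \<in> J \<times> {..<N}" for p
    proof -
      obtain j i where p: "p = (j, i)" "j \<in> J" using \<open>p \<in> J \<times> {..<N}\<close> by (rule SigmaE)
      have "C j \<le> (\<Sum>j\<in>J. C j)" using p(2) assms(1) C by (intro member_le_sum) auto
      then have "C j * l / real N \<le> (\<Sum>j\<in>J. C j) * l / real N"
        using \<open>0 \<le> l\<close> by (intro divide_right_mono mult_right_mono) auto
      also have "\<dots> \<le> \<delta>" using N N0 \<open>\<delta> > 0\<close> by (simp add: field_simps)
      finally show ?thesis using diam[OF p(2), of i] p by simp
    qed
    have "(\<Sum>p\<in>J \<times> {..<N}. diameter (U p)) \<le> (\<Sum>p\<in>J \<times> {..<N}. C (fst p) * l / real N)"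
      using diam by (intro sum_mono) auto
    also have "\<dots> = (\<Sum>j\<in>J. \<Sum>i<N. C j * l / real N)"
      unfolding sum.cartesian_product by (intro sum.cong) auto
    also have "\<dots> = (\<Sum>j\<in>J. l * C j)" using N0 by (simp add: mult.commute)
    finally show "(\<Sum>p\<in>J \<times> {..<N}. diameter (U p)) \<le> l * (\<Sum>j\<in>J. C j)"
      by (simp add: sum_distrib_left)
  qed
qed

definition circle_param :: "real^2 \<Rightarrow> real \<Rightarrow> real \<Rightarrow> real^2" where
  "circle_param a r t = a + vector [r * cos t, r * sin t]"

lemma norm_real2: "norm (x :: real^2) = sqrt ((x$1)\<^sup>2 + (x$2)\<^sup>2)"
  by (simp add: norm_vec_def L2_set_def sum_2)

lemma sphere_subset_circle_param:
  assumes "0 \<le> r"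
  shows "sphere a r \<subseteq> circle_param a r ` {0..2 * pi}"
proof
  fix x assume x: "x \<in> sphere a r"
  show "x \<in> circle_param a r ` {0..2 * pi}"
  proof (cases "r = 0")
    case True
    have "vector [0, 0] = (0 :: real^2)" by (simp add: vec_eq_iff forall_2)
    then show ?thesis using x True by (auto simp: circle_param_def image_iff intro!: bexI[of _ 0])
  next
    case False
    then have r: "r > 0" using assms by simp
    let ?y = "x - a"
    have "norm ?y = r" using x by (simp add: dist_norm norm_minus_commute)
    moreover have "norm ?y = sqrt ((?y$1)\<^sup>2 + (?y$2)\<^sup>2)"
      by (rule norm_real2)
    ultimately have "(?y$1)\<^sup>2 + (?y$2)\<^sup>2 = r\<^sup>2" 
      by (metis real_sqrt_pow2 sum_power2_ge_zero)
    then have "(?y$1 / r)\<^sup>2 + (?y$2 / r)\<^sup>2 = 1"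
      using r by (simp add: power_divide flip: add_divide_distrib)
    then obtain t where t: "0 \<le> t" "t < 2 * pi" "?y$1 / r = cos t" "?y$2 / r = sin t"
      using sincos_total_2pi by metis
    then have "x = circle_param a r t"
      using r by (simp add: circle_param_def vec_eq_iff forall_2 field_simps)
    then show ?thesis using t by auto
  qed
qed

text \<open>The chord between the two points has length 2 r |sin ((s - t) / 2)|.\<close>

lemma circle_param_Lipschitz:
  assumes "0 \<le> r"
  shows "dist (circle_param a r s) (circle_param a r t) \<le> r * \<bar>s - t\<bar>"
proof -
  have "circle_param a r s - circle_param a r t = vector [r * (cos s - cos t), r * (sin s - sin t)]"
    by (simp add: circle_param_def vec_eq_iff forall_2 algebra_simps)
  then have "dist (circle_param a r s) (circle_param a r t)
      = sqrt (r\<^sup>2 * ((cos s - cos t)\<^sup>2 + (sin s - sin t)\<^sup>2))"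
    by (simp add: dist_norm norm_real2 power_mult_distrib distrib_left)
  also have "(cos s - cos t)\<^sup>2 + (sin s - sin t)\<^sup>2 = (2 * sin ((s - t) / 2))\<^sup>2"
  proof -
    have "(cos s - cos t)\<^sup>2 + (sin s - sin t)\<^sup>2
        = ((cos s)\<^sup>2 + (sin s)\<^sup>2) + ((cos t)\<^sup>2 + (sin t)\<^sup>2) - 2 * (cos s * cos t + sin s * sin t)"
      by (simp add: power2_eq_square algebra_simps)
    also have "\<dots> = 2 - 2 * cos (s - t)" by (simp add: cos_diff)
    also have "\<dots> = 2 - 2 * cos (2 * ((s - t) / 2))" by (simp only: mult_2 field_sum_of_halves)
    also have "\<dots> = (2 * sin ((s - t) / 2))\<^sup>2"
      unfolding cos_double_sin by (simp add: power2_eq_square)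
    finally show ?thesis .
  qed
  also have "sqrt (r\<^sup>2 * (2 * sin ((s - t) / 2))\<^sup>2) = r * (2 * \<bar>sin ((s - t) / 2)\<bar>)"
    using assms by (simp add: real_sqrt_mult abs_mult)
  also have "\<dots> \<le> r * \<bar>s - t\<bar>"
    using abs_sin_x_le_abs_x[of "(s - t) / 2"] assms by (intro mult_left_mono) auto
  finally show ?thesis .
qed

lemma hausdorff1_UN_sphere_le:
  fixes a :: "'j \<Rightarrow> real^2"
  assumes "finite J" "\<And>j. j \<in> J \<Longrightarrow> 0 \<le> r j" "A \<subseteq> (\<Union>j\<in>J. sphere (a j) (r j))"
  shows "hausdorff1 A \<le> ennreal (2 * pi * (\<Sum>j\<in>J. r j))"
proof (rule hausdorff1_UN_Lipschitz_image_le)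
  show "A \<subseteq> (\<Union>j\<in>J. circle_param (a j) (r j) ` {0..2 * pi})"
    using assms(2,3) sphere_subset_circle_param by (smt (verit) UN_iff subset_iff)
qed (use assms circle_param_Lipschitz in auto)

section \<open>Smooth boundaries\<close>

lemma Ck_on_const: "Ck_on k S (\<lambda>x. c)"
  by (induction k arbitrary: c) (auto simp: frechet_derivative_const)

lemma Ck_on_affine:
  fixes v :: "'a::euclidean_space"
  shows "Ck_on k S (\<lambda>x. x \<bullet> v + c)"
proof (cases k)
  case 0
  then show ?thesis by (auto intro!: continuous_intros)
next
  case (Suc m)
  have D: "((\<lambda>x. x \<bullet> v + c) has_derivative (\<lambda>h. h \<bullet> v)) (at x)" for x :: 'a
    by (auto intro!: derivative_eq_intros)
  show ?thesis
    unfolding Suc using D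
    by (auto simp: frechet_derivative_at[OF D, symmetric] Ck_on_const intro: differentiableI)
qed

lemma has_derivative_sphere_function:
  fixes a :: "'a::euclidean_space"
  shows "((\<lambda>x. s * ((x - a) \<bullet> (x - a)) + c) has_derivative (\<lambda>h. h \<bullet> ((2 * s) *\<^sub>R (x - a)))) (at x)"
  by (auto intro!: derivative_eq_intros simp: inner_commute algebra_simps)

text \<open>Its directional derivatives are affine, so one step of the recursion reduces to
  \<open>Ck_on_affine\<close>.\<close>

lemma Ck_on_sphere_function:
  fixes a :: "'a::euclidean_space"
  shows "Ck_on k S (\<lambda>x. s * ((x - a) \<bullet> (x - a)) + c)"
proof (cases k)
  case 0
  then show ?thesis by (auto intro!: continuous_intros)
next
  case (Suc m)
  have "Ck_on m S (\<lambda>x. x \<bullet> ((2 * s) *\<^sub>R b) + - (a \<bullet> ((2 * s) *\<^sub>R b)))" for b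
    by (rule Ck_on_affine)
  moreover have "(\<lambda>x. x \<bullet> ((2 * s) *\<^sub>R b) + - (a \<bullet> ((2 * s) *\<^sub>R b))) = (\<lambda>x. b \<bullet> ((2 * s) *\<^sub>R (x - a)))" for b
    by (auto simp: algebra_simps inner_commute)
  ultimately have "Ck_on m S (\<lambda>x. b \<bullet> ((2 * s) *\<^sub>R (x - a)))" for b
    by metis
  then show ?thesis
    unfolding Suc Ck_on.simps(2)
    by (metis (no_types, lifting) has_derivative_sphere_function frechet_derivative_at differentiableI ext)
qed

lemma gradient_eqI:
  assumes "(f has_derivative (\<lambda>h. h \<bullet> g)) (at x)"
  shows "gradient f x = g"
  using euclidean_representation[of g]
  by (simp add: gradient_def frechet_derivative_at[OF assms, symmetric] inner_commute)

text \<open>The sign of \<open>s\<close> selects the side of the sphere: positive for the ball,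
  negative for its exterior. The gradient vanishes only at the centre, which a chart of radius at
  most r around a point of the sphere does not contain.\<close>

lemma smooth_boundary_sphere_chart:
  fixes a :: "'a::euclidean_space"
  assumes "p \<in> sphere a r" "0 < r" "0 < e" "s \<noteq> 0"
    and "\<And>x. x \<in> ball p e \<Longrightarrow> x \<in> E \<longleftrightarrow> s * ((x - a) \<bullet> (x - a)) < s * r\<^sup>2"
  shows "\<exists>d>0. \<exists>\<phi>. smooth_on (ball p d) \<phi> \<and>
     (\<forall>x\<in>ball p d. gradient \<phi> x \<noteq> 0) \<and> E \<inter> ball p d = {x \<in> ball p d. \<phi> x < 0}"
proof (intro exI conjI)
  let ?d = "min e r" and ?\<phi> = "\<lambda>x. s * ((x - a) \<bullet> (x - a)) + (- s * r\<^sup>2)"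
  show "0 < ?d" using assms by simp
  show "smooth_on (ball p ?d) ?\<phi>"
    unfolding smooth_on_def using Ck_on_sphere_function by blast
  show "\<forall>x\<in>ball p ?d. gradient ?\<phi> x \<noteq> 0"
  proof
    fix x assume x: "x \<in> ball p ?d"
    have "x \<noteq> a" using x assms(1) by (auto simp: dist_commute)
    moreover have "gradient ?\<phi> x = (2 * s) *\<^sub>R (x - a)"
      by (rule gradient_eqI[OF has_derivative_sphere_function])
    ultimately show "gradient ?\<phi> x \<noteq> 0" using assms(4) by simp
  qed
  show "E \<inter> ball p ?d = {x \<in> ball p ?d. ?\<phi> x < 0}"
    using assms(5) by auto
qed

lemma smooth_boundary_ball:
  assumes "0 < r"
  shows "smooth_boundary (ball a r)"
  unfolding smooth_boundary_def
proof
  fix p assume p: "p \<in> frontier (ball a r)"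
  show "\<exists>d>0. \<exists>\<phi>. smooth_on (ball p d) \<phi> \<and>
     (\<forall>x\<in>ball p d. gradient \<phi> x \<noteq> 0) \<and> ball a r \<inter> ball p d = {x \<in> ball p d. \<phi> x < 0}"
  proof (rule smooth_boundary_sphere_chart[where s=1 and e=1])
    show "p \<in> sphere a r" using p assms by (simp add: frontier_ball)
    show "x \<in> ball a r \<longleftrightarrow> 1 * ((x - a) \<bullet> (x - a)) < 1 * r\<^sup>2" for x
      using assms power_less_imp_less_base[of "norm (x - a)" 2 r]
      by (auto simp: dist_norm norm_minus_commute power_strict_mono simp flip: power2_norm_eq_inner)
  qed (use assms in auto)
qed

lemma frontier_diff_cball_subset: "frontier (E - cball a r) \<subseteq> frontier E \<union> sphere (a::'a::euclidean_space) r"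
proof -
  have "frontier (E - cball a r) \<subseteq> frontier E \<union> frontier (- cball a r)"
    unfolding Diff_eq using frontier_Int_subset by blast
  then show ?thesis by (simp add: frontier_complement frontier_cball)
qed

text \<open>Points of the old frontier lie outside the open set \<open>E\<close>, hence away from
  the closed ball, and keep a restriction of their old chart. Points of the new sphere lie inside
  \<open>E\<close> and get the chart of the exterior.\<close>

lemma smooth_boundary_diff_cball:
  assumes "open E" "smooth_boundary E" "cball a r \<subseteq> E" "0 < r"
  shows "smooth_boundary (E - cball a r)"
  unfolding smooth_boundary_def
proof
  fix p assume "p \<in> frontier (E - cball a r)"
  then have "p \<in> frontier E \<or> p \<in> sphere a r"
    using frontier_diff_cball_subset by blast
  moreover have "p \<notin> cball a r" if "p \<in> frontier E"
    using that assms(1,3) by (auto simp: frontier_def interior_open)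
  ultimately consider "p \<in> frontier E" "p \<notin> cball a r" | "p \<in> sphere a r"
    by blast
  then show "\<exists>d>0. \<exists>\<phi>. smooth_on (ball p d) \<phi> \<and>
     (\<forall>x\<in>ball p d. gradient \<phi> x \<noteq> 0) \<and> (E - cball a r) \<inter> ball p d = {x \<in> ball p d. \<phi> x < 0}"
  proof cases
    case 1
    obtain d \<phi> where d: "d > 0" "smooth_on (ball p d) \<phi>" "\<forall>x\<in>ball p d. gradient \<phi> x \<noteq> 0"
        "E \<inter> ball p d = {x \<in> ball p d. \<phi> x < 0}"
      using assms(2) 1 unfolding smooth_boundary_def by blast
    have "open (ball p d - cball a r)" "p \<in> ball p d - cball a r" using 1 d by (auto simp: open_Diff)
    then obtain e where e: "e > 0" "ball p e \<subseteq> ball p d - cball a r" using open_contains_ball by blast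
    have Ck: "Ck_on k S f \<Longrightarrow> T \<subseteq> S \<Longrightarrow> Ck_on k T f" for k and S T :: "'a set" and f
      by (induction k arbitrary: f) (auto intro: continuous_on_subset)
    have "smooth_on (ball p e) \<phi>"
      using d(2) Ck[of _ "ball p d" \<phi> "ball p e"] e unfolding smooth_on_def by blast
    moreover have "x \<in> E \<longleftrightarrow> \<phi> x < 0" if "x \<in> ball p e" for x
      using d(4) e(2) that by blast
    ultimately show ?thesis using d(3) e by (intro exI[of _ e] conjI exI[of _ \<phi>]) auto
  next
    case 2
    then have "p \<in> E" using assms(3) by auto
    then obtain e where e: "e > 0" "ball p e \<subseteq> E" using assms(1) open_contains_ball by blast
    show ?thesis
    proof (rule smooth_boundary_sphere_chart[where s="-1" and r=r and e=e])
      show "x \<in> E - cball a r \<longleftrightarrow> - 1 * ((x - a) \<bullet> (x - a)) < - 1 * r\<^sup>2" if "x \<in> ball p e" for x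
      proof -
        have "x \<in> E" using that e by blast
        moreover have "norm (x - a) > r \<longleftrightarrow> (norm (x - a))\<^sup>2 > r\<^sup>2"
          using assms(4) power_less_imp_less_base[of r 2 "norm (x - a)"] by (auto simp: power_strict_mono)
        ultimately show ?thesis
          by (auto simp: dist_norm norm_minus_commute not_le simp flip: power2_norm_eq_inner)
      qed
    qed (use 2 assms e in auto)
  qed
qed

lemma perforated_smooth_boundary:
  fixes E :: "'a::euclidean_space set"
  assumes "open E" "smooth_boundary E" "0 < r" "finite I"
    and "\<And>i. i \<in> I \<Longrightarrow> cball (a i) r \<subseteq> E"
    and "\<And>i j. i \<in> I \<Longrightarrow> j \<in> I \<Longrightarrow> i \<noteq> j \<Longrightarrow> cball (a i) r \<inter> cball (a j) r = {}"
  shows "smooth_boundary (E - (\<Union>i\<in>I. cball (a i) r)) \<and>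
    frontier (E - (\<Union>i\<in>I. cball (a i) r)) \<subseteq> frontier E \<union> (\<Union>i\<in>I. sphere (a i) r)"
  using assms(4-6)
proof (induction I)
  case empty
  then show ?case using assms by simp
next
  case (insert i I)
  let ?E = "E - (\<Union>i\<in>I. cball (a i) r)"
  have IH: "smooth_boundary ?E" "frontier ?E \<subseteq> frontier E \<union> (\<Union>i\<in>I. sphere (a i) r)"
    using insert by simp_all
  have "open ?E"
    using assms(1) insert.hyps by (intro open_Diff closed_UN) auto
  moreover have "cball (a i) r \<subseteq> ?E"
  proof -
    have "cball (a i) r \<inter> cball (a j) r = {}" if "j \<in> I" for j
      using insert.prems(2)[of i j] insert.hyps(2) that by auto
    then show ?thesis using insert.prems(1)[of i] by auto
  qed
  ultimately have "smooth_boundary (?E - cball (a i) r)"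
    using smooth_boundary_diff_cball IH(1) assms(3) by blast
  moreover have "?E - cball (a i) r = E - (\<Union>i\<in>insert i I. cball (a i) r)"
    by auto
  ultimately show ?case
    using frontier_diff_cball_subset[of ?E "a i" r] IH(2) by auto
qed

section \<open>A Poincare inequality in the presence of small holes\<close>

lemma integrable_continuous_compact_support:
  fixes h :: "'a::euclidean_space \<Rightarrow> real"
  assumes "continuous_on UNIV h" "compact K" "\<And>x. x \<notin> K \<Longrightarrow> h x = 0"
  shows "integrable lborel h"
proof -
  have "integrable lborel (\<lambda>x. indicator K x *\<^sub>R h x)"
    using assms(1,2) by (intro borel_integrable_compact continuous_on_subset[OF assms(1)]) auto
  moreover have "(\<lambda>x. indicator K x *\<^sub>R h x) = h"
    using assms(3) by (auto simp: indicator_def fun_eq_iff)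
  ultimately show ?thesis by simp
qed

text \<open>Instead of Fubini's theorem, the proof differentiates the translation-invariant integral.\<close>

lemma integral_directional_derivative_eq_0:
  fixes g h :: "'a::euclidean_space \<Rightarrow> real"
  assumes D: "\<And>x. (g has_derivative g' x) (at x)" and h: "\<And>x. h x = g' x b"
    and cont: "continuous_on UNIV h" and K: "compact K" "\<And>x. x \<notin> K \<Longrightarrow> g x = 0"
  shows "integrable lborel h" "integral\<^sup>L lborel h = 0"
proof -
  have h0: "h x = 0" if "x \<notin> K" for x
  proof -
    have "(g has_derivative (\<lambda>_. 0)) (at x)"
    proof (rule has_derivative_transform_within_open)
      show "((\<lambda>_. 0) has_derivative (\<lambda>_. 0)) (at x)" by simp
      show "open (- K)" using K(1) by (simp add: compact_imp_closed open_Compl)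
    qed (use K(2) that in auto)
    then have "g' x = (\<lambda>_. 0)" by (rule has_derivative_unique[OF D])
    then show ?thesis by (simp add: h)
  qed
  show inth: "integrable lborel h"
    by (rule integrable_continuous_compact_support[OF cont K(1) h0])
  have contg: "continuous_on UNIV g"
    using D has_derivative_continuous_on by blast
  have intg: "integrable lborel g"
    by (rule integrable_continuous_compact_support[OF contg K])
  obtain R where R: "\<And>x. x \<in> K \<Longrightarrow> norm x \<le> R" "R > 0"
    using compact_imp_bounded[OF K(1)] by (auto simp: bounded_pos)
  obtain B where B: "B > 0" "\<And>x. \<bar>h x\<bar> \<le> B"
  proof -
    have "bounded (h ` K)"
      by (intro compact_imp_bounded compact_continuous_image continuous_on_subset[OF cont] K(1)) simp
    then obtain B where B: "B > 0" "\<And>x. x \<in> K \<Longrightarrow> \<bar>h x\<bar> \<le> B"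
      by (auto simp: bounded_pos)
    then have "\<bar>h x\<bar> \<le> B" for x using h0[of x] by (cases "x \<in> K") auto
    then show thesis using that B(1) by blast
  qed
  have DERIV: "((\<lambda>t. g (x + t *\<^sub>R b)) has_real_derivative h (x + t *\<^sub>R b)) (at t)" for x t
  proof -
    have "((\<lambda>t. g (x + t *\<^sub>R b)) has_derivative (\<lambda>s. g' (x + t *\<^sub>R b) (s *\<^sub>R b))) (at t)"
      by (rule has_derivative_compose[OF _ D]) (auto intro!: derivative_eq_intros)
    moreover have "g' (x + t *\<^sub>R b) (s *\<^sub>R b) = h (x + t *\<^sub>R b) * s" for s
      using linear_scale[OF has_derivative_linear[OF D]] h by (simp add: mult.commute)
    ultimately show ?thesis by (simp add: has_field_derivative_def)
  qed
  define e where "e n = 1 / real (Suc n)" for n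
  have e: "0 < e n" "e n \<le> 1" for n by (auto simp: e_def)
  have e0: "e \<longlonglongrightarrow> 0" unfolding e_def using LIMSEQ_inverse_real_of_nat by (simp add: inverse_eq_divide)
  define s where "s n x = (g (x + e n *\<^sub>R b) - g x) / e n" for n x
  have trans: "integrable lborel (\<lambda>x. g (x + c))" "integral\<^sup>L lborel (\<lambda>x. g (x + c)) = integral\<^sup>L lborel g" for c
  proof -
    have eq: "lborel = distr lborel borel ((+) c)" by (simp add: lborel_distr_plus)
    have m: "g \<in> borel_measurable borel" using contg by (rule borel_measurable_continuous_onI)
    show "integral\<^sup>L lborel (\<lambda>x. g (x + c)) = integral\<^sup>L lborel g"
      by (subst (2) eq) (use m in \<open>simp add: integral_distr add.commute\<close>)
    have "integrable (distr lborel borel ((+) c)) g" using intg by (simp add: lborel_distr_plus)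
    then show "integrable lborel (\<lambda>x. g (x + c))"
      using m by (subst (asm) integrable_distr_eq) (auto simp: add.commute)
  qed
  have "integral\<^sup>L lborel (s n) = 0" for n
    unfolding s_def using trans[of "e n *\<^sub>R b"] intg by simp
  moreover have "(\<lambda>n. integral\<^sup>L lborel (s n)) \<longlonglongrightarrow> integral\<^sup>L lborel h"
  proof (rule integral_dominated_convergence)
    show "h \<in> borel_measurable lborel" using inth by simp
    show "s n \<in> borel_measurable lborel" for n
      unfolding s_def using trans(1)[of "e n *\<^sub>R b"] intg by simp
    \<comment> \<open>The increments \<open>e n\<close> are at most 1, so every difference quotient
      vanishes outside this enlarged ball; inside it the mean value theorem bounds the quotient by
      B.\<close>
    show "integrable lborel (\<lambda>x::'a. B * indicator (cball 0 (R + norm b)) x :: real)"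
      by (intro integrable_mult_right integrable_real_indicator) (use emeasure_lborel_cball_finite[of "0::'a" "R + norm b"] in auto)
    show "AE x in lborel. (\<lambda>n. s n x) \<longlonglongrightarrow> h x"
    proof (rule AE_I2)
      fix x
      have "((\<lambda>t. (g (x + (0 + t) *\<^sub>R b) - g (x + 0 *\<^sub>R b)) / t) \<longlongrightarrow> h (x + 0 *\<^sub>R b)) (at 0)"
        using DERIV[of x 0] unfolding DERIV_def .
      then have "((\<lambda>t. (g (x + t *\<^sub>R b) - g x) / t) \<longlongrightarrow> h x) (at 0)" by simp
      moreover have "filterlim e (at 0) sequentially"
        using e0 less_imp_neq[OF e(1)] by (simp add: filterlim_at)
      ultimately show "(\<lambda>n. s n x) \<longlonglongrightarrow> h x"
        unfolding s_def by (rule filterlim_compose)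
    qed
    show "AE x in lborel. norm (s n x) \<le> B * indicator (cball 0 (R + norm b)) x" for n
    proof (rule AE_I2)
      fix x
      show "norm (s n x) \<le> B * indicator (cball 0 (R + norm b)) x"
      proof (cases "x \<in> cball 0 (R + norm b)")
        case False
        then have n: "norm x > R + norm b" by simp
        have "norm (e n *\<^sub>R b) \<le> norm b" using e[of n] by (simp add: mult_left_le_one_le)
        then have "norm (x + e n *\<^sub>R b) > R" "norm x > R"
          using n norm_diff_ineq[of x "e n *\<^sub>R b"] norm_ge_zero[of b] by linarith+
        then have "x \<notin> K" "x + e n *\<^sub>R b \<notin> K" using R(1) not_le by blast+
        then show ?thesis using K(2) B(1) by (simp add: s_def)
      next
        case True
        obtain z where "g (x + e n *\<^sub>R b) - g (x + 0 *\<^sub>R b) = (e n - 0) * h (x + z *\<^sub>R b)"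
          using MVT2[OF e(1)[of n] DERIV] by metis
        then have "s n x = h (x + z *\<^sub>R b)" using e(1)[of n] by (simp add: s_def)
        then show ?thesis using B True by simp
      qed
    qed
  qed
  ultimately show "integral\<^sup>L lborel h = 0"
    by (simp add: LIMSEQ_const_iff)
qed

section \<open>The radial field around one hole\<close>

text \<open>Squaring makes the truncation continuously differentiable, hence the square in the
  cutoff of \<open>radial_coeff\<close>.\<close>

lemma DERIV_max_0_power2: "((\<lambda>x::real. (max 0 x)\<^sup>2) has_real_derivative 2 * max 0 x) (at x)"
proof -
  consider "x > 0" | "x < 0" | "x = 0" by linarith
  then show ?thesis
  proof cases
    case 1
    have "((\<lambda>x::real. x\<^sup>2) has_real_derivative 2 * max 0 x) (at x)"
      using 1 by (auto intro!: derivative_eq_intros)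
    then show ?thesis
      by (rule has_field_derivative_transform_within_open[where S="{0<..}"]) (use 1 in auto)
  next
    case 2
    have "((\<lambda>x::real. 0) has_real_derivative 2 * max 0 x) (at x)"
      using 2 by simp
    then show ?thesis
      by (rule has_field_derivative_transform_within_open[where S="{..<0}"]) (use 2 in auto)
  next
    case 3
    have "((\<lambda>h::real. max 0 h) \<longlongrightarrow> max 0 0) (at 0)" by (intro tendsto_intros)
    then have "((\<lambda>h::real. max 0 h) \<longlongrightarrow> 0) (at 0)" by simp
    moreover have "eventually (\<lambda>h::real. max 0 h = ((max 0 (0 + h))\<^sup>2 - (max 0 0)\<^sup>2) / h) (at 0)"
      by (auto simp: eventually_at_filter power2_eq_square max_def)
    ultimately have "((\<lambda>h::real. ((max 0 (0 + h))\<^sup>2 - (max 0 0)\<^sup>2) / h) \<longlongrightarrow> 0) (at 0)"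
      by (rule Lim_transform_eventually)
    then show ?thesis unfolding 3 DERIV_def by simp
  qed
qed

text \<open>With \<open>q = \<bar>x - z\<bar>\<^sup>2\<close>, the function \<open>log_barrier \<epsilon> q = 1 + log (\<bar>x - z\<bar> / \<epsilon>)\<close> is harmonic
  away from \<open>z\<close>. The field \<open>- radial_coeff \<epsilon> q (x - z)\<close> is minus its logarithmic gradient, cut off
  at distance 8.\<close>

definition log_barrier :: "real \<Rightarrow> real \<Rightarrow> real" where
  "log_barrier \<epsilon> q = 1 + ln (q / \<epsilon>\<^sup>2) / 2"

definition radial_coeff :: "real \<Rightarrow> real \<Rightarrow> real" where
  "radial_coeff \<epsilon> q = (max 0 (1 - q / 64))\<^sup>2 / (q * log_barrier \<epsilon> q)"

text \<open>The quotient rule for the derivative of \<open>radial_coeff\<close> in q; the summand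
  1/2 is q times the derivative 1 / (2 q) of the barrier.\<close>

definition radial_coeff' :: "real \<Rightarrow> real \<Rightarrow> real" where
  "radial_coeff' \<epsilon> q = (- (max 0 (1 - q / 64) / 32) * (q * log_barrier \<epsilon> q)
     - (max 0 (1 - q / 64))\<^sup>2 * (log_barrier \<epsilon> q + 1 / 2)) / (q * log_barrier \<epsilon> q)\<^sup>2"

text \<open>At the threshold the barrier equals 1 - ln 2 > 0. The threshold lies strictly inside the
  hole, so the coefficients are differentiable on an open set that contains the boundary of the
  hole.\<close>

lemma log_barrier_pos:
  assumes "0 < \<epsilon>" "\<epsilon>\<^sup>2 / 4 < q"
  shows "0 < log_barrier \<epsilon> q"
proof -
  have "1 / 4 < q / \<epsilon>\<^sup>2" using assms by (simp add: field_simps)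
  then have "ln (1 / 4) < ln (q / \<epsilon>\<^sup>2)"
    by (subst ln_less_cancel_iff) linarith+
  moreover have "ln (1 / 4 :: real) = - (2 * ln 2)"
    using ln_realpow[of 2 2] by (simp add: ln_div)
  ultimately show ?thesis
    unfolding log_barrier_def using ln_2_less_1 by linarith
qed

lemma DERIV_radial_coeff:
  assumes "0 < \<epsilon>" "\<epsilon>\<^sup>2 / 4 < q"
  shows "(radial_coeff \<epsilon> has_real_derivative radial_coeff' \<epsilon> q) (at q)"
proof -
  have q: "0 < q" using assms by (smt (verit) zero_le_power2 divide_nonneg_nonneg)
  have G: "0 < log_barrier \<epsilon> q" using log_barrier_pos assms .
  have dG: "(log_barrier \<epsilon> has_real_derivative 1 / (2 * q)) (at q)"
    unfolding log_barrier_def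
    by (rule derivative_eq_intros refl | use q assms(1) in \<open>simp add: field_simps power2_eq_square\<close>)+
  have dm: "((\<lambda>q. (max 0 (1 - q / 64))\<^sup>2) has_real_derivative - (max 0 (1 - q / 64) / 32)) (at q)"
  proof -
    have "((\<lambda>q. 1 - q / 64 :: real) has_real_derivative - 1 / 64) (at q)"
      by (auto intro!: derivative_eq_intros)
    from DERIV_chain2[OF DERIV_max_0_power2 this] show ?thesis by simp
  qed
  have "((\<lambda>q. (max 0 (1 - q / 64))\<^sup>2 / (q * log_barrier \<epsilon> q)) has_real_derivative
      (- (max 0 (1 - q / 64) / 32) * (q * log_barrier \<epsilon> q)
       - (max 0 (1 - q / 64))\<^sup>2 * (1 * log_barrier \<epsilon> q + 1 / (2 * q) * q))
      / ((q * log_barrier \<epsilon> q) * (q * log_barrier \<epsilon> q))) (at q)"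
    by (intro DERIV_divide dm DERIV_mult[OF DERIV_ident dG]) (use q G in simp)
  then show ?thesis
    unfolding radial_coeff_def[abs_def] radial_coeff'_def
    using q by (simp add: power2_eq_square)
qed

lemma continuous_on_radial_coeff:
  assumes "0 < \<epsilon>"
  shows "continuous_on {\<epsilon>\<^sup>2 / 4<..} (radial_coeff \<epsilon>)" "continuous_on {\<epsilon>\<^sup>2 / 4<..} (radial_coeff' \<epsilon>)"
proof -
  show "continuous_on {\<epsilon>\<^sup>2 / 4<..} (radial_coeff \<epsilon>)"
    using DERIV_radial_coeff[OF assms]
    by (intro continuous_at_imp_continuous_on ballI DERIV_isCont) auto
  have q: "0 < q" if "\<epsilon>\<^sup>2 / 4 < q" for q
    using that assms by (smt (verit) zero_le_power2 divide_nonneg_nonneg)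
  have "continuous_on {\<epsilon>\<^sup>2 / 4<..} (log_barrier \<epsilon>)"
    unfolding log_barrier_def using assms by (intro continuous_intros) (auto dest!: q)
  then show "continuous_on {\<epsilon>\<^sup>2 / 4<..} (radial_coeff' \<epsilon>)"
    unfolding radial_coeff'_def
    by (intro continuous_intros ballI) (use log_barrier_pos[OF assms] q in \<open>auto simp: less_imp_neq[symmetric]\<close>)
qed

text \<open>The left side is div X - |X|^2 for X = - \<open>radial_coeff \<epsilon> q\<close> (x -
  z) in the plane. With y = 1 - q / 64 and G the barrier, it equals y / (16 G) + y^2 (1 - y^2) / (q
  G^2): the first term comes from the gradient of the cutoff, and the second is nonnegative.\<close>

lemma radial_coeff_Riccati:
  assumes "0 < \<epsilon>" "\<epsilon>\<^sup>2 \<le> q" "q < 64"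
  shows "- 2 * radial_coeff \<epsilon> q - 2 * q * radial_coeff' \<epsilon> q - q * (radial_coeff \<epsilon> q)\<^sup>2
    \<ge> (1 - q / 64) / (16 * log_barrier \<epsilon> q)"
proof -
  define G where "G = log_barrier \<epsilon> q"
  define y where "y = 1 - q / 64"
  have e: "0 < \<epsilon>\<^sup>2" using assms by simp
  have q: "0 < q" using assms e by linarith
  have G: "0 < G" unfolding G_def using assms e q by (intro log_barrier_pos) linarith+
  have y: "0 < y" "y < 1" using assms q by (auto simp: y_def)
  have "- 2 * radial_coeff \<epsilon> q - 2 * q * radial_coeff' \<epsilon> q - q * (radial_coeff \<epsilon> q)\<^sup>2
     = y / (16 * G) + y\<^sup>2 * (1 - y\<^sup>2) / (q * G\<^sup>2)"
    unfolding radial_coeff_def radial_coeff'_def G_def[symmetric] y_def[symmetric]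
    using q G y by (simp add: field_simps power2_eq_square)
  moreover have "0 \<le> y\<^sup>2 * (1 - y\<^sup>2) / (q * G\<^sup>2)"
    using y q by (intro divide_nonneg_nonneg mult_nonneg_nonneg) (auto simp: power_le_one)
  ultimately show ?thesis by (simp add: y_def G_def)
qed

text \<open>For q \<le> 16 the factor 1 - q / 64 is at least 3/4, whence 3/64, and the barrier is at
  most its value 1 + ln (4 / \<epsilon>) at distance 4.\<close>

lemma radial_coeff_Riccati_inner:
  assumes "0 < \<epsilon>" "\<epsilon>\<^sup>2 \<le> q" "q \<le> 16" "\<epsilon> \<le> 4"
  shows "- 2 * radial_coeff \<epsilon> q - 2 * q * radial_coeff' \<epsilon> q - q * (radial_coeff \<epsilon> q)\<^sup>2
    \<ge> 3 / (64 * (1 + ln (4 / \<epsilon>)))"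
proof -
  have e: "0 < \<epsilon>\<^sup>2" using assms by simp
  have q: "0 < q" using assms e by linarith
  have G: "0 < log_barrier \<epsilon> q" using assms e q by (intro log_barrier_pos) linarith+
  have "ln (q / \<epsilon>\<^sup>2) \<le> ln ((4 / \<epsilon>)\<^sup>2)"
  proof (subst ln_le_cancel_iff)
    show "0 < q / \<epsilon>\<^sup>2" using q e by (rule divide_pos_pos)
    show "q / \<epsilon>\<^sup>2 \<le> (4 / \<epsilon>)\<^sup>2" using assms by (simp add: power_divide divide_right_mono)
  qed (use assms in simp)
  also have "\<dots> = 2 * ln (4 / \<epsilon>)" using assms by (simp add: ln_realpow)
  finally have le: "log_barrier \<epsilon> q \<le> 1 + ln (4 / \<epsilon>)" unfolding log_barrier_def by linarith
  have "3 / (64 * (1 + ln (4 / \<epsilon>))) \<le> 3 / (64 * log_barrier \<epsilon> q)"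
    using le G by (intro divide_left_mono) auto
  also have "\<dots> \<le> (1 - q / 64) / (16 * log_barrier \<epsilon> q)"
    using G assms by (simp add: field_simps)
  also have "\<dots> \<le> - 2 * radial_coeff \<epsilon> q - 2 * q * radial_coeff' \<epsilon> q - q * (radial_coeff \<epsilon> q)\<^sup>2"
    using assms by (intro radial_coeff_Riccati) auto
  finally show ?thesis .
qed

section \<open>Integrating the field against the square of a test function\<close>

lemma smooth_on_UNIV_gradient:
  assumes "smooth_on UNIV u"
  shows "(u has_derivative (\<lambda>h. h \<bullet> gradient u x)) (at x)" "continuous_on UNIV (gradient u)"
proof -
  have C: "Ck_on (Suc 0) UNIV u" using assms unfolding smooth_on_def by blast
  then show "(u has_derivative (\<lambda>h. h \<bullet> gradient u x)) (at x)"
    using GDERIV_gradient[of u x] by (simp add: gderiv_def)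
  show "continuous_on UNIV (gradient u)"
    unfolding gradient_def[abs_def] using C by (intro continuous_intros) auto
qed

lemma norm_square_completion:
  fixes p v :: "'a::real_inner"
  shows "2 * u * (p \<bullet> v) \<ge> - (norm p)\<^sup>2 - u\<^sup>2 * (norm v)\<^sup>2"
proof -
  have "0 \<le> (p + u *\<^sub>R v) \<bullet> (p + u *\<^sub>R v)" by simp
  also have "\<dots> = (norm p)\<^sup>2 + 2 * u * (p \<bullet> v) + u\<^sup>2 * (norm v)\<^sup>2"
    unfolding power2_norm_eq_inner
    by (simp add: inner_add_left inner_add_right inner_commute power2_eq_square algebra_simps)
  finally show ?thesis by linarith
qed

text \<open>\<open>h b\<close> is the derivative in direction \<open>b\<close> of u^2 times the
  component of the field along \<open>b\<close>. The field is singular only inside the hole, where u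
  vanishes, so the product extends by zero. Continuity is glued from two open sets that cover the
  plane: the hole, and the region beyond half its radius.\<close>

lemma integral_divergence_radial_field_eq_0:
  fixes u :: "real^2 \<Rightarrow> real"
  assumes \<epsilon>: "0 < \<epsilon>" and u: "smooth_on UNIV u" "compact K" "\<And>x. x \<notin> K \<Longrightarrow> u x = 0"
    and hole: "\<And>x. x \<in> ball z \<epsilon> \<Longrightarrow> u x = 0"
  defines "h \<equiv> \<lambda>b x. let q = (x - z) \<bullet> (x - z) in
      2 * u x * (gradient u x \<bullet> b) * (- radial_coeff \<epsilon> q * ((x - z) \<bullet> b))
      + (u x)\<^sup>2 * (- radial_coeff \<epsilon> q - 2 * radial_coeff' \<epsilon> q * ((x - z) \<bullet> b)\<^sup>2)"
  assumes b: "b \<in> Basis"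
  shows "integrable lborel (h b)" "integral\<^sup>L lborel (h b) = 0"
proof -
  define X where "X x = - radial_coeff \<epsilon> ((x - z) \<bullet> (x - z)) * ((x - z) \<bullet> b)" for x
  define g where "g x = (u x)\<^sup>2 * X x" for x
  define g' where "g' x v = (if x \<in> ball z \<epsilon> then 0 else
     2 * u x * (v \<bullet> gradient u x) * X x + (u x)\<^sup>2 *
      (- (radial_coeff' \<epsilon> ((x - z) \<bullet> (x - z)) * (2 * (v \<bullet> (x - z)))) * ((x - z) \<bullet> b)
       - radial_coeff \<epsilon> ((x - z) \<bullet> (x - z)) * (v \<bullet> b)))" for x v
  let ?U = "{x. \<epsilon>\<^sup>2 / 4 < (x - z) \<bullet> (x - z)}"
  have out: "\<epsilon>\<^sup>2 \<le> (x - z) \<bullet> (x - z)" if "x \<notin> ball z \<epsilon>" for x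
  proof -
    have "\<epsilon> \<le> norm (x - z)" using that by (simp add: dist_norm norm_minus_commute)
    then show ?thesis using \<epsilon> by (simp add: power_mono flip: power2_norm_eq_inner)
  qed
  have e4: "\<epsilon>\<^sup>2 / 4 < \<epsilon>\<^sup>2" using \<epsilon> by simp
  have D: "(g has_derivative g' x) (at x)" for x
  proof (cases "x \<in> ball z \<epsilon>")
    case True
    have "(g has_derivative (\<lambda>_. 0)) (at x)"
    proof (rule has_derivative_transform_within_open[where s="ball z \<epsilon>"])
      show "((\<lambda>_. 0) has_derivative (\<lambda>_. 0)) (at x)" by simp
    qed (use True hole in \<open>auto simp: g_def\<close>)
    then show ?thesis using True by (simp add: g'_def[abs_def])
  next
    case False
    have q: "\<epsilon>\<^sup>2 / 4 < (x - z) \<bullet> (x - z)" using out[OF False] e4 by linarith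
    have Dq: "((\<lambda>x. (x - z) \<bullet> (x - z)) has_derivative (\<lambda>v. 2 * (v \<bullet> (x - z)))) (at x)"
      by (auto intro!: derivative_eq_intros simp: inner_commute)
    have DF: "((\<lambda>x. radial_coeff \<epsilon> ((x - z) \<bullet> (x - z))) has_derivative
        (\<lambda>v. radial_coeff' \<epsilon> ((x - z) \<bullet> (x - z)) * (2 * (v \<bullet> (x - z))))) (at x)"
      using has_derivative_compose[OF Dq DERIV_radial_coeff[OF \<epsilon> q, unfolded has_field_derivative_def]] .
    note Du = smooth_on_UNIV_gradient(1)[OF u(1), of x]
    have "(g has_derivative (\<lambda>v. 2 * u x * (v \<bullet> gradient u x) * X x + (u x)\<^sup>2 *
      (- (radial_coeff' \<epsilon> ((x - z) \<bullet> (x - z)) * (2 * (v \<bullet> (x - z)))) * ((x - z) \<bullet> b)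
       - radial_coeff \<epsilon> ((x - z) \<bullet> (x - z)) * (v \<bullet> b)))) (at x)"
      unfolding g_def[abs_def] X_def[abs_def]
      by (rule derivative_eq_intros DF Du refl)+ (auto simp: fun_eq_iff algebra_simps)
    moreover have "g' x = (\<lambda>v. 2 * u x * (v \<bullet> gradient u x) * X x + (u x)\<^sup>2 *
      (- (radial_coeff' \<epsilon> ((x - z) \<bullet> (x - z)) * (2 * (v \<bullet> (x - z)))) * ((x - z) \<bullet> b)
       - radial_coeff \<epsilon> ((x - z) \<bullet> (x - z)) * (v \<bullet> b)))"
      using False by (simp add: g'_def[abs_def])
    ultimately show ?thesis by simp
  qed
  have hg: "h b x = g' x b" for x
  proof (cases "x \<in> ball z \<epsilon>")
    case True
    then have "g' x b = 0" by (simp add: g'_def)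
    moreover have "h b x = 0" unfolding h_def Let_def hole[OF True] by simp
    ultimately show ?thesis by simp
  next
    case False
    then have "g' x b = 2 * u x * (b \<bullet> gradient u x) * X x + (u x)\<^sup>2 *
      (- (radial_coeff' \<epsilon> ((x - z) \<bullet> (x - z)) * (2 * (b \<bullet> (x - z)))) * ((x - z) \<bullet> b)
       - radial_coeff \<epsilon> ((x - z) \<bullet> (x - z)) * (b \<bullet> b))"
      by (simp add: g'_def)
    also have "b \<bullet> b = 1" using b by simp
    finally show ?thesis
      unfolding h_def Let_def X_def inner_commute[of b] by (simp add: power2_eq_square)
  qed
  have contu: "continuous_on UNIV u"
    by (rule has_derivative_continuous_on[OF smooth_on_UNIV_gradient(1)[OF u(1)]])
  have "continuous_on ?U (h b)"
  proof -
    have "continuous_on ?U (\<lambda>x. radial_coeff \<epsilon> ((x - z) \<bullet> (x - z)))"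
         "continuous_on ?U (\<lambda>x. radial_coeff' \<epsilon> ((x - z) \<bullet> (x - z)))"
      by (rule continuous_on_compose2[OF continuous_on_radial_coeff(1)[OF \<epsilon>]]
          continuous_on_compose2[OF continuous_on_radial_coeff(2)[OF \<epsilon>]];
          auto intro!: continuous_intros)+
    moreover have "continuous_on ?U u" "continuous_on ?U (gradient u)"
      using contu smooth_on_UNIV_gradient(2)[OF u(1)] by (auto intro: continuous_on_subset)
    ultimately show ?thesis
      unfolding h_def Let_def by (intro continuous_intros)
  qed
  moreover have "continuous_on (ball z \<epsilon>) (h b)"
    by (rule continuous_on_eq[OF continuous_on_const[of _ 0]]) (use hole in \<open>simp add: h_def Let_def\<close>)
  moreover have "open ?U"
    by (intro open_Collect_less continuous_intros)
  ultimately have "continuous_on (?U \<union> ball z \<epsilon>) (h b)"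
    by (intro continuous_on_open_Un) auto
  moreover have "?U \<union> ball z \<epsilon> = UNIV"
  proof -
    have "x \<in> ?U" if "x \<notin> ball z \<epsilon>" for x
      unfolding mem_Collect_eq using out[OF that] e4 by (rule less_le_trans[rotated])
    then show ?thesis by blast
  qed
  ultimately have cont: "continuous_on UNIV (h b)" by simp
  have g0: "g x = 0" if "x \<notin> K" for x using u(3)[OF that] by (simp add: g_def)
  show "integrable lborel (h b)" "integral\<^sup>L lborel (h b) = 0"
    by (rule integral_directional_derivative_eq_0[OF D hg cont u(2) g0], assumption)+
qed

text \<open>Completing the square gives div (u^2 X) \<ge> u^2 (div X - |X|^2) - |grad u|^2, and the
  left side integrates to 0. The bracket is at least the stated constant up to distance 4 and
  nonnegative up to 8, where X ends; therefore the two balls differ.\<close>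

lemma local_Poincare:
  fixes u :: "real^2 \<Rightarrow> real"
  assumes \<epsilon>: "0 < \<epsilon>" "\<epsilon> \<le> 4" and u: "smooth_on UNIV u" "compact K" "\<And>x. x \<notin> K \<Longrightarrow> u x = 0"
    and hole: "\<And>x. x \<in> ball z \<epsilon> \<Longrightarrow> u x = 0"
    and int: "integrable lborel (\<lambda>x. (u x)\<^sup>2)" "integrable lborel (\<lambda>x. (norm (gradient u x))\<^sup>2)"
  shows "3 / (64 * (1 + ln (4 / \<epsilon>))) * (\<integral>x. indicator (cball z 4) x * (u x)\<^sup>2 \<partial>lborel)
    \<le> (\<integral>x. indicator (ball z 8) x * (norm (gradient u x))\<^sup>2 \<partial>lborel)"
proof -
  define h where "h \<equiv> \<lambda>b x. let q = (x - z) \<bullet> (x - z) in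
      2 * u x * (gradient u x \<bullet> b) * (- radial_coeff \<epsilon> q * ((x - z) \<bullet> b))
      + (u x)\<^sup>2 * (- radial_coeff \<epsilon> q - 2 * radial_coeff' \<epsilon> q * ((x - z) \<bullet> b)\<^sup>2)"
  have h: "integrable lborel (h b)" "integral\<^sup>L lborel (h b) = 0" if "b \<in> Basis" for b
    unfolding h_def by (rule integral_divergence_radial_field_eq_0[OF \<epsilon>(1) u hole that], assumption+)+
  define H where "H x = (\<Sum>b\<in>Basis. h b x)" for x
  have H: "integrable lborel H" "integral\<^sup>L lborel H = 0"
    unfolding H_def using h by (auto simp: Bochner_Integration.integral_sum)
  define c where "c = 3 / (64 * (1 + ln (4 / \<epsilon>)))"
  have int1: "integrable lborel (\<lambda>x. indicator (cball z 4) x * (u x)\<^sup>2)"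
    using integrable_mult_indicator[OF _ int(1), of "cball z 4"] by simp
  have int2: "integrable lborel (\<lambda>x. indicator (ball z 8) x * (norm (gradient u x))\<^sup>2)"
    using integrable_mult_indicator[OF _ int(2), of "ball z 8"] by simp
  have H_eq: "H x = 2 * u x * (gradient u x \<bullet> (- radial_coeff \<epsilon> q *\<^sub>R (x - z)))
      + (u x)\<^sup>2 * (- 2 * radial_coeff \<epsilon> q - 2 * q * radial_coeff' \<epsilon> q)"
    if q: "q = (x - z) \<bullet> (x - z)" for x q
  proof -
    have "H x = (- 2 * u x * radial_coeff \<epsilon> q) * (\<Sum>b\<in>Basis. (gradient u x \<bullet> b) * ((x - z) \<bullet> b))
       + (u x)\<^sup>2 * (\<Sum>b\<in>(Basis :: (real^2) set). - radial_coeff \<epsilon> q)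
       - 2 * (u x)\<^sup>2 * radial_coeff' \<epsilon> q * (\<Sum>b\<in>Basis. ((x - z) \<bullet> b) * ((x - z) \<bullet> b))"
      unfolding H_def h_def Let_def q[symmetric]
      by (simp add: sum_distrib_left sum.distrib[symmetric] sum_subtractf[symmetric] algebra_simps power2_eq_square
          del: sum_constant)
    then show ?thesis
      unfolding euclidean_inner[symmetric] q[symmetric] by (simp add: algebra_simps)
  qed
  have pw: "c * (indicator (cball z 4) x * (u x)\<^sup>2) - indicator (ball z 8) x * (norm (gradient u x))\<^sup>2 \<le> H x" for x
  proof -
    define q where "q = (x - z) \<bullet> (x - z)"
    have qn: "q = (dist z x)\<^sup>2" by (simp add: q_def dist_norm norm_minus_commute power2_norm_eq_inner)
    note Hx = H_eq[OF q_def]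
    consider "x \<in> ball z \<epsilon>" | "dist z x \<ge> 8" | "dist z x \<ge> \<epsilon>" "dist z x < 8" by fastforce
    then show ?thesis
    proof cases
      case 1
      then show ?thesis unfolding Hx using hole[OF 1] by simp
    next
      case 2
      then have "64 \<le> q" unfolding qn using power_mono[of 8 "dist z x" 2] by simp
      then have "radial_coeff \<epsilon> q = 0" "radial_coeff' \<epsilon> q = 0"
        by (auto simp: radial_coeff_def radial_coeff'_def max_def)
      then show ?thesis unfolding Hx using 2 by simp
    next
      case 3
      then have q: "\<epsilon>\<^sup>2 \<le> q" "q < 64"
        unfolding qn using \<epsilon> power_mono[of \<epsilon> "dist z x" 2] power_strict_mono[of "dist z x" 8 2] by auto
      let ?Q = "- 2 * radial_coeff \<epsilon> q - 2 * q * radial_coeff' \<epsilon> q - q * (radial_coeff \<epsilon> q)\<^sup>2"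
      have le: "c * indicator (cball z 4) x \<le> ?Q"
      proof (cases "x \<in> cball z 4")
        case True
        then have "q \<le> 16" unfolding qn using power_mono[of "dist z x" 4 2] by simp
        then show ?thesis using radial_coeff_Riccati_inner[OF \<epsilon>(1) q(1)] \<epsilon>(2) True by (simp add: c_def)
      next
        case False
        have "0 < log_barrier \<epsilon> q" 
          using \<epsilon> q zero_less_power[OF \<epsilon>(1), of 2] by (intro log_barrier_pos) linarith+
        then have "0 \<le> (1 - q / 64) / (16 * log_barrier \<epsilon> q)"
          using q by simp
        then show ?thesis using radial_coeff_Riccati[OF \<epsilon>(1) q] False by simp
      qed
      have "norm (- radial_coeff \<epsilon> q *\<^sub>R (x - z)) ^ 2 = q * (radial_coeff \<epsilon> q)\<^sup>2"
        unfolding power2_norm_eq_inner by (simp add: q_def power2_eq_square)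
      then have "- (norm (gradient u x))\<^sup>2 - (u x)\<^sup>2 * (q * (radial_coeff \<epsilon> q)\<^sup>2)
          \<le> 2 * u x * (gradient u x \<bullet> (- radial_coeff \<epsilon> q *\<^sub>R (x - z)))"
        using norm_square_completion[of "gradient u x" "u x" "- radial_coeff \<epsilon> q *\<^sub>R (x - z)"] by simp
      then have "(u x)\<^sup>2 * ?Q - (norm (gradient u x))\<^sup>2 \<le> H x"
        unfolding Hx right_diff_distrib by linarith
      moreover have "(u x)\<^sup>2 * (c * indicator (cball z 4) x) \<le> (u x)\<^sup>2 * ?Q"
        using le by (rule mult_left_mono) simp
      ultimately show ?thesis using 3 by (simp add: mult_ac)
    qed
  qed
  have "(\<integral>x. c * (indicator (cball z 4) x * (u x)\<^sup>2) - indicator (ball z 8) x * (norm (gradient u x))\<^sup>2 \<partial>lborel)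
     \<le> integral\<^sup>L lborel H"
    by (rule integral_mono) (use int1 int2 H pw in auto)
  then show ?thesis using int1 int2 H by (simp add: c_def)
qed

section \<open>From one hole to many\<close>

text \<open>Sum the local inequalities: the balls of radius 4 cover the support, and the balls of
  radius 8 count the gradient at most M times at each point.\<close>

lemma Poincare_many_holes:
  fixes u :: "real^2 \<Rightarrow> real"
  assumes \<epsilon>: "0 < \<epsilon>" "\<epsilon> \<le> 4" and u: "smooth_on UNIV u" "compact K" "\<And>x. x \<notin> K \<Longrightarrow> u x = 0"
    and int: "integrable lborel (\<lambda>x. (u x)\<^sup>2)" "integrable lborel (\<lambda>x. (norm (gradient u x))\<^sup>2)"
    and I: "finite I" and hole: "\<And>i x. i \<in> I \<Longrightarrow> x \<in> ball (z i) \<epsilon> \<Longrightarrow> u x = 0"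
    and cover: "\<And>x. x \<in> K \<Longrightarrow> \<exists>i\<in>I. x \<in> cball (z i) 4"
    and mult: "\<And>x. card {i \<in> I. x \<in> ball (z i) 8} \<le> M"
  shows "3 / (64 * (1 + ln (4 / \<epsilon>))) * (\<integral>x. (u x)\<^sup>2 \<partial>lborel)
    \<le> real M * (\<integral>x. (norm (gradient u x))\<^sup>2 \<partial>lborel)"
proof -
  define c where "c = 3 / (64 * (1 + ln (4 / \<epsilon>)))"
  have "0 \<le> ln (4 / \<epsilon>)" using \<epsilon> by (intro ln_ge_zero) simp
  then have c: "0 \<le> c" by (simp add: c_def)
  have int1: "integrable lborel (\<lambda>x. indicator (cball (z i) 4) x * (u x)\<^sup>2)" for i
    using integrable_mult_indicator[OF _ int(1), of "cball (z i) 4"] by simp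
  have int2: "integrable lborel (\<lambda>x. indicator (ball (z i) 8) x * (norm (gradient u x))\<^sup>2)" for i
    using integrable_mult_indicator[OF _ int(2), of "ball (z i) 8"] by simp
  have "(\<integral>x. (u x)\<^sup>2 \<partial>lborel) \<le> (\<integral>x. (\<Sum>i\<in>I. indicator (cball (z i) 4) x * (u x)\<^sup>2) \<partial>lborel)"
  proof (rule integral_mono)
    fix x
    show "(u x)\<^sup>2 \<le> (\<Sum>i\<in>I. indicator (cball (z i) 4) x * (u x)\<^sup>2)"
    proof (cases "x \<in> K")
      case True
      then obtain i where i: "i \<in> I" "x \<in> cball (z i) 4" using cover by blast
      have "indicator (cball (z i) 4) x * (u x)\<^sup>2 \<le> (\<Sum>i\<in>I. indicator (cball (z i) 4) x * (u x)\<^sup>2)"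
        using i I by (intro member_le_sum) auto
      then show ?thesis using i by simp
    qed (use u(3) in \<open>simp add: sum_nonneg\<close>)
  qed (use int int1 in auto)
  also have "\<dots> = (\<Sum>i\<in>I. \<integral>x. indicator (cball (z i) 4) x * (u x)\<^sup>2 \<partial>lborel)"
    using int1 by (intro Bochner_Integration.integral_sum) auto
  finally have "c * (\<integral>x. (u x)\<^sup>2 \<partial>lborel) \<le> c * (\<Sum>i\<in>I. \<integral>x. indicator (cball (z i) 4) x * (u x)\<^sup>2 \<partial>lborel)"
    using c by (rule mult_left_mono)
  also have "\<dots> \<le> (\<Sum>i\<in>I. \<integral>x. indicator (ball (z i) 8) x * (norm (gradient u x))\<^sup>2 \<partial>lborel)"
    unfolding sum_distrib_left c_def
    by (intro sum_mono local_Poincare[OF \<epsilon> u hole int])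
  also have "\<dots> = (\<integral>x. (\<Sum>i\<in>I. indicator (ball (z i) 8) x * (norm (gradient u x))\<^sup>2) \<partial>lborel)"
    using int2 by (intro Bochner_Integration.integral_sum[symmetric]) auto
  also have "\<dots> \<le> (\<integral>x. real M * (norm (gradient u x))\<^sup>2 \<partial>lborel)"
  proof (rule integral_mono)
    fix x
    have "(\<Sum>i\<in>I. indicator (ball (z i) 8) x * (norm (gradient u x))\<^sup>2)
        = real (card {i \<in> I. x \<in> ball (z i) 8}) * (norm (gradient u x))\<^sup>2"
      unfolding sum_distrib_right[symmetric] using I
      by (simp add: indicator_def sum.If_cases Int_def)
    then show "(\<Sum>i\<in>I. indicator (ball (z i) 8) x * (norm (gradient u x))\<^sup>2) \<le> real M * (norm (gradient u x))\<^sup>2"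
      using mult[of x] by (simp add: mult_right_mono)
  qed (use int int2 in auto)
  finally show ?thesis by (simp add: c_def)
qed

text \<open>A hole here is any disc disjoint from \<Omega>, be it removed from the interior or lying
  beyond the outer boundary, since test functions are extended by zero.\<close>

lemma dirichlet_eigenvalue_many_holes:
  fixes z :: "'i \<Rightarrow> real^2"
  assumes \<epsilon>: "0 < \<epsilon>" "\<epsilon> \<le> 4" and I: "finite I" and hole: "\<And>i. i \<in> I \<Longrightarrow> ball (z i) \<epsilon> \<inter> \<Omega> = {}"
    and cover: "\<And>x. x \<in> \<Omega> \<Longrightarrow> \<exists>i\<in>I. x \<in> cball (z i) 4"
    and mult: "\<And>x. card {i \<in> I. x \<in> ball (z i) 8} \<le> M" and M: "0 < M"
  shows "ennreal (3 / (64 * (1 + ln (4 / \<epsilon>)) * real M)) \<le> dirichlet_eigenvalue \<Omega>"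
  unfolding dirichlet_eigenvalue_def
proof (rule INF_greatest)
  fix u assume "u \<in> test_functions \<Omega> - {\<lambda>x. 0}"
  then have u: "smooth_on UNIV u" "compact (closure {x. u x \<noteq> 0})" "closure {x. u x \<noteq> 0} \<subseteq> \<Omega>" "u \<noteq> (\<lambda>x. 0)"
    by (auto simp: test_functions_def)
  let ?K = "closure {x. u x \<noteq> 0}"
  have u0: "u x = 0" if "x \<notin> ?K" for x using that closure_subset[of "{x. u x \<noteq> 0}"] by auto
  have contu: "continuous_on UNIV u"
    by (rule has_derivative_continuous_on[OF smooth_on_UNIV_gradient(1)[OF u(1)]])
  have int: "integrable lborel (\<lambda>x. (u x)\<^sup>2)" "integrable lborel (\<lambda>x. (norm (gradient u x))\<^sup>2)"
  proof -
    have "continuous_on UNIV (\<lambda>x. (u x)\<^sup>2)" "continuous_on UNIV (\<lambda>x. (norm (gradient u x))\<^sup>2)"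
      by (rule continuous_on_power continuous_on_norm contu smooth_on_UNIV_gradient(2)[OF u(1)])+
    moreover have "(u x)\<^sup>2 = 0" "(norm (gradient u x))\<^sup>2 = 0" if "x \<notin> ?K" for x
      using u0[OF that] gradient_eq_0_outside_support[OF that] by auto
    ultimately show "integrable lborel (\<lambda>x. (u x)\<^sup>2)" "integrable lborel (\<lambda>x. (norm (gradient u x))\<^sup>2)"
      using integrable_continuous_compact_support[OF _ u(2)] by blast+
  qed
  let ?a = "\<integral>x. (u x)\<^sup>2 \<partial>lborel" and ?b = "\<integral>x. (norm (gradient u x))\<^sup>2 \<partial>lborel"
  have ineq: "3 / (64 * (1 + ln (4 / \<epsilon>))) * ?a \<le> real M * ?b"
  proof (rule Poincare_many_holes[OF \<epsilon> u(1,2) u0 int I _ _ mult])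
    show "u x = 0" if "i \<in> I" "x \<in> ball (z i) \<epsilon>" for i x
      using hole[OF that(1)] that(2) u(3) by (intro u0) blast
    show "\<exists>i\<in>I. x \<in> cball (z i) 4" if "x \<in> ?K" for x using that u(3) cover by blast
  qed
  have L2: "L2_norm_squared \<Omega> u = ennreal ?a"
  proof -
    have "L2_norm_squared \<Omega> u = L2_norm_squared UNIV u"
      by (rule L2_norm_squared_extend[OF subset_UNIV], rule u0) (use u(3) in blast)
    also have "\<dots> = ennreal ?a"
      unfolding L2_norm_squared_def using int(1) by (simp add: nn_integral_eq_integral)
    finally show ?thesis .
  qed
  have L2g: "L2_norm_squared \<Omega> (gradient u) = ennreal ?b"
  proof -
    have "L2_norm_squared \<Omega> (gradient u) = L2_norm_squared UNIV (gradient u)"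
      by (rule L2_norm_squared_extend[OF subset_UNIV], rule gradient_eq_0_outside_support) (use u(3) in blast)
    also have "\<dots> = ennreal ?b"
      unfolding L2_norm_squared_def using int(2) by (simp add: nn_integral_eq_integral)
    finally show ?thesis .
  qed
  have apos: "?a > 0"
  proof -
    have "?a \<noteq> 0"
    proof
      assume "?a = 0"
      then have ae: "AE x in lborel. (u x)\<^sup>2 = 0"
        using integral_nonneg_eq_0_iff_AE[OF int(1)] by simp
      obtain x0 where x0: "u x0 \<noteq> 0" using u(4) by auto
      have "open {x. u x \<noteq> 0}"
        by (rule open_Collect_neq[OF contu continuous_on_const])
      moreover have "x0 \<in> {x. u x \<noteq> 0}" using x0 by simp
      ultimately obtain r where r: "r > 0" "ball x0 r \<subseteq> {x. u x \<noteq> 0}"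
        by (rule openE)
      from ae have "AE x in lborel. x \<notin> ball x0 r"
        by (rule eventually_mono) (use r(2) in force)
      then have "emeasure lborel {x \<in> space lborel. \<not> x \<notin> ball x0 r} = 0"
        by (subst (asm) AE_iff_measurable[OF _ refl]) simp_all
      then have "emeasure lborel (ball x0 r) = 0" by (simp add: ball_def)
      then have "measure lborel (ball x0 r) = 0" by (simp add: measure_def)
      then show False using content_ball_pos[OF r(1), of x0] by simp
    qed
    moreover have "?a \<ge> 0" by simp
    ultimately show ?thesis by linarith
  qed
  have "3 / (64 * (1 + ln (4 / \<epsilon>))) * ?a / real M \<le> real M * ?b / real M"
    using ineq by (rule divide_right_mono) simp
  then have "3 / (64 * (1 + ln (4 / \<epsilon>)) * real M) * ?a \<le> ?b"
    using M by simp
  then have "3 / (64 * (1 + ln (4 / \<epsilon>)) * real M) \<le> ?b / ?a"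
    using apos by (simp add: pos_le_divide_eq)
  then have "ennreal (3 / (64 * (1 + ln (4 / \<epsilon>)) * real M)) \<le> ennreal (?b / ?a)"
    by (rule ennreal_leI)
  also have "\<dots> = ennreal ?b / ennreal ?a"
    using apos by (intro divide_ennreal[symmetric]) auto
  finally show "ennreal (3 / (64 * (1 + ln (4 / \<epsilon>)) * real M)) \<le> L2_norm_squared \<Omega> (gradient u) / L2_norm_squared \<Omega> u"
    by (simp add: L2 L2g)
qed

section \<open>Discs with many holes\<close>

definition lattice_point :: "int \<times> int \<Rightarrow> real^2" where
  "lattice_point p = vector [of_int (fst p), of_int (snd p)]"

lemma norm_lattice_point_power2:
  "(norm (lattice_point p))\<^sup>2 = (of_int (fst p))\<^sup>2 + (of_int (snd p))\<^sup>2"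
  by (simp add: lattice_point_def norm_real2)

lemma dist_lattice_point_ge_1:
  assumes "p \<noteq> q"
  shows "1 \<le> dist (lattice_point p) (lattice_point q)"
proof -
  have "lattice_point p - lattice_point q = lattice_point (fst p - fst q, snd p - snd q)"
    by (simp add: lattice_point_def vec_eq_iff forall_2)
  then have "(dist (lattice_point p) (lattice_point q))\<^sup>2 = of_int ((fst p - fst q)\<^sup>2 + (snd p - snd q)\<^sup>2)"
    by (simp add: dist_norm norm_lattice_point_power2)
  moreover have "1 \<le> (fst p - fst q)\<^sup>2 + (snd p - snd q)\<^sup>2"
  proof -
    have "(fst p - fst q)\<^sup>2 + (snd p - snd q)\<^sup>2 \<noteq> 0"
      using assms by (simp add: sum_power2_eq_zero_iff prod_eq_iff)
    moreover have "0 \<le> (fst p - fst q)\<^sup>2 + (snd p - snd q)\<^sup>2" by simp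
    ultimately show ?thesis by linarith
  qed
  ultimately have "1\<^sup>2 \<le> (dist (lattice_point p) (lattice_point q))\<^sup>2"
    by (metis of_int_1_le_iff one_power2)
  then show ?thesis by (rule power2_le_imp_le) simp
qed

lemma disjoint_lattice_cballs:
  assumes "p \<noteq> q" "r \<le> 1/4"
  shows "cball (lattice_point p) r \<inter> cball (lattice_point q) r = {}"
proof -
  have "\<not> (dist (lattice_point p) x \<le> r \<and> dist (lattice_point q) x \<le> r)" for x
    using dist_lattice_point_ge_1[OF assms(1)] assms(2)
      dist_triangle2[of "lattice_point p" "lattice_point q" x] by linarith
  then show ?thesis by auto
qed

lemma abs_lattice_point_le:
  assumes "norm (lattice_point p) \<le> real m"
  shows "p \<in> {- int m..int m} \<times> {- int m..int m}"
proof -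
  have "\<bar>lattice_point p $ i\<bar> \<le> real m" for i
    using component_le_norm_cart[of "lattice_point p" i] assms by linarith
  from this[of 1] this[of 2] show ?thesis
    by (cases p) (auto simp: lattice_point_def)
qed

lemma finite_lattice_disc: "finite {p. norm (lattice_point p) \<le> real m}"
  by (rule finite_subset[of _ "{- int m..int m} \<times> {- int m..int m}"])
    (use abs_lattice_point_le in auto)

lemma card_lattice_disc: "card {p. norm (lattice_point p) \<le> real m} \<le> (2 * m + 1)\<^sup>2"
proof -
  have "card {p. norm (lattice_point p) \<le> real m} \<le> card ({- int m..int m} \<times> {- int m..int m})"
    by (intro card_mono) (use abs_lattice_point_le in auto)
  also have "\<dots> = (2 * m + 1)\<^sup>2"
    by (simp add: card_cartesian_product power2_eq_square nat_add_distrib nat_mult_distrib flip: mult_2)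
  finally show ?thesis .
qed

text \<open>Each coordinate of \<open>p\<close> is confined to 17 consecutive integers, and 289 =
  17^2.\<close>

lemma card_lattice_near_le:
  "card {p \<in> I. x \<in> ball (lattice_point p) 8} \<le> 289"
proof -
  let ?S = "{\<lfloor>x$1\<rfloor> - 8..\<lfloor>x$1\<rfloor> + 8} \<times> {\<lfloor>x$2\<rfloor> - 8..\<lfloor>x$2\<rfloor> + 8}"
  have "p \<in> ?S" if "x \<in> ball (lattice_point p) 8" for p
  proof -
    have "\<bar>(lattice_point p - x) $ i\<bar> < 8" for i
      using component_le_norm_cart[of "lattice_point p - x" i] that by (simp add: dist_norm)
    from this[of 1] this[of 2] have "\<bar>of_int (fst p) - x$1\<bar> < 8" "\<bar>of_int (snd p) - x$2\<bar> < 8"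
      by (auto simp: lattice_point_def)
    then show ?thesis by (cases p) (auto; linarith)
  qed
  then have "card {p \<in> I. x \<in> ball (lattice_point p) 8} \<le> card ?S"
    by (intro card_mono) auto
  also have "\<dots> = 289" by (simp add: card_cartesian_product)
  finally show ?thesis .
qed

lemma exists_near_lattice_point: "\<exists>p. dist (lattice_point p) x \<le> 1"
proof (rule exI)
  let ?p = "(round (x$1), round (x$2))"
  have c: "((lattice_point ?p - x) $ 1)\<^sup>2 \<le> 1/4" "((lattice_point ?p - x) $ 2)\<^sup>2 \<le> 1/4"
    using of_int_round_abs_le[of "x$1"] of_int_round_abs_le[of "x$2"]
      power_mono[of "\<bar>of_int (round (x$1)) - x$1\<bar>" "1/2" 2] power_mono[of "\<bar>of_int (round (x$2)) - x$2\<bar>" "1/2" 2]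
    by (auto simp: lattice_point_def power2_eq_square)
  then show "dist (lattice_point ?p) x \<le> 1"
    unfolding dist_norm norm_real2 by (intro real_le_lsqrt) auto
qed

text \<open>Moving both coordinates by 2 away from 0 adds 4 (a + b) + 8 to N^2, where N is the norm
  and a, b are the absolute values of the coordinates. As N \<le> a + b, this is at least 4 N + 4.
  The displacement is sqrt 8 \<le> 3.\<close>

lemma exists_outer_lattice_point:
  "\<exists>q. norm (lattice_point p) + 2 \<le> norm (lattice_point q) \<and> dist (lattice_point q) (lattice_point p) \<le> 3"
proof -
  define s :: "int \<Rightarrow> int" where "s i = (if i \<ge> 0 then 1 else - 1)" for i
  define q where "q = (fst p + 2 * s (fst p), snd p + 2 * s (snd p))"
  let ?a = "\<bar>of_int (fst p) :: real\<bar>" and ?b = "\<bar>of_int (snd p) :: real\<bar>" and ?N = "norm (lattice_point p)"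
  have N: "?N\<^sup>2 = ?a\<^sup>2 + ?b\<^sup>2" using norm_lattice_point_power2[of p] by simp
  have "?N\<^sup>2 \<le> (?a + ?b)\<^sup>2" unfolding N by (simp add: power2_sum)
  then have "?N \<le> ?a + ?b" by (rule power2_le_imp_le) simp
  have "(norm (lattice_point q))\<^sup>2 = (?a + 2)\<^sup>2 + (?b + 2)\<^sup>2"
    unfolding norm_lattice_point_power2 q_def s_def by (auto simp: power2_eq_square algebra_simps)
  then have "(?N + 2)\<^sup>2 \<le> (norm (lattice_point q))\<^sup>2"
    using N \<open>?N \<le> ?a + ?b\<close> by (simp add: power2_sum)
  then have "?N + 2 \<le> norm (lattice_point q)" by (rule power2_le_imp_le) simp
  moreover have "dist (lattice_point q) (lattice_point p) \<le> 3"
    unfolding dist_norm norm_real2 by (intro real_le_lsqrt) (auto simp: lattice_point_def q_def s_def)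
  ultimately show ?thesis by blast
qed

section \<open>Perforated discs and their competitors\<close>

definition holes :: "nat \<Rightarrow> (int \<times> int) set" where
  "holes n = {p. norm (lattice_point p) \<le> real n}"

definition perforated_disc :: "nat \<Rightarrow> (real^2) set" where
  "perforated_disc n = ball 0 (real n + 1) - (\<Union>p\<in>holes n. cball (lattice_point p) (1 / (8 * real n)))"

text \<open>Compared with \<open>perforated_disc\<close> the holes have twice the radius and the
  outer radius is smaller by 1/2, so that the closure fits inside.\<close>

definition perforated_competitor :: "nat \<Rightarrow> (real^2) set" where
  "perforated_competitor n = ball 0 (real n + 1/2) - (\<Union>p\<in>holes n. cball (lattice_point p) (1 / (4 * real n)))"

lemma finite_holes: "finite (holes n)"
  unfolding holes_def by (rule finite_lattice_disc)

lemma card_holes_le: "0 < n \<Longrightarrow> card (holes n) \<le> 9 * n\<^sup>2"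
proof -
  assume "0 < n"
  then have "(2 * n + 1)\<^sup>2 \<le> (3 * n)\<^sup>2" by (intro power_mono) auto
  then show ?thesis using card_lattice_disc[of n] by (simp add: holes_def power_mult_distrib)
qed

lemma hole_subset:
  assumes "p \<in> holes n" "r \<le> 1/4"
  shows "cball (lattice_point p) r \<subseteq> ball 0 (real n + 1/2)"
proof
  fix x assume "x \<in> cball (lattice_point p) r"
  then show "x \<in> ball 0 (real n + 1/2)"
    using assms norm_triangle_sub[of x "lattice_point p"]
    by (simp add: holes_def dist_norm norm_minus_commute)
qed

lemma perforated_competitor_admissible:
  assumes "0 < n"
  shows "open (perforated_competitor n)" "smooth_boundary (perforated_competitor n)"
    "compact (closure (perforated_competitor n))" "closure (perforated_competitor n) \<subseteq> perforated_disc n"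
    "frontier (perforated_competitor n) \<subseteq>
       sphere 0 (real n + 1/2) \<union> (\<Union>p\<in>holes n. sphere (lattice_point p) (1 / (4 * real n)))"
proof -
  have r: "0 < 1 / (4 * real n)" "1 / (4 * real n) \<le> 1/4" "1 / (8 * real n) < 1 / (4 * real n)"
    using assms by (auto simp: field_simps)
  show "open (perforated_competitor n)"
    unfolding perforated_competitor_def using finite_holes by (intro open_Diff closed_UN) auto
  have *: "smooth_boundary (perforated_competitor n) \<and> frontier (perforated_competitor n) \<subseteq>
       frontier (ball 0 (real n + 1/2)) \<union> (\<Union>p\<in>holes n. sphere (lattice_point p) (1 / (4 * real n)))"
    unfolding perforated_competitor_def
    by (rule perforated_smooth_boundary)
      (use r finite_holes hole_subset disjoint_lattice_cballs in \<open>auto intro!: smooth_boundary_ball\<close>)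
  then show "smooth_boundary (perforated_competitor n)" by blast
  show "frontier (perforated_competitor n) \<subseteq>
       sphere 0 (real n + 1/2) \<union> (\<Union>p\<in>holes n. sphere (lattice_point p) (1 / (4 * real n)))"
    using * by (simp add: frontier_ball)
  \<comment> \<open>A closed set squeezed between the competitor and
    \<open>perforated_disc n\<close>.\<close>
  let ?C = "cball 0 (real n + 1/2) - (\<Union>p\<in>holes n. ball (lattice_point p) (1 / (4 * real n)))"
  have "closed ?C" by (intro closed_Diff open_UN) auto
  moreover have "perforated_competitor n \<subseteq> ?C"
    unfolding perforated_competitor_def by (intro Diff_mono UN_mono) auto
  ultimately have cl: "closure (perforated_competitor n) \<subseteq> ?C" by (rule closure_minimal[rotated])
  have "bounded (perforated_competitor n)"
    unfolding perforated_competitor_def by (rule bounded_subset[OF bounded_ball]) auto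
  then show "compact (closure (perforated_competitor n))" by (simp add: compact_closure)
  have "?C \<subseteq> perforated_disc n"
    unfolding perforated_disc_def using r(3) by (intro Diff_mono UN_mono) auto
  with cl show "closure (perforated_competitor n) \<subseteq> perforated_disc n" by blast
qed

lemma emeasure_perforated_competitor:
  assumes "0 < n"
  shows "ennreal ((real n)\<^sup>2) \<le> emeasure lborel (perforated_competitor n)"
proof -
  let ?E = "perforated_competitor n" and ?r = "1 / (4 * real n)"
  let ?U = "\<Union>p\<in>holes n. cball (lattice_point p) ?r"
  have bd: "bounded ?E"
    unfolding perforated_competitor_def by (rule bounded_subset[OF bounded_ball]) auto
  have mE: "?E \<in> sets lborel" using perforated_competitor_admissible(1)[OF assms] by simp
  have fin: "emeasure lborel ?E = ennreal (measure lborel ?E)"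
    using emeasure_bounded_finite[OF bd] by (intro emeasure_eq_ennreal_measure) auto
  have cb: "emeasure lborel (cball (lattice_point p) ?r) = ennreal (pi * ?r\<^sup>2)" for p
    by (subst emeasure_cball) (auto simp: unit_ball_vol_2)
  have "ennreal (pi * (real n + 1/2)\<^sup>2) = emeasure lborel (ball (0::real^2) (real n + 1/2))"
    by (subst emeasure_ball) (auto simp: unit_ball_vol_2)
  also have "\<dots> \<le> emeasure lborel (?E \<union> ?U)"
    using mE finite_holes by (intro emeasure_mono) (auto simp: perforated_competitor_def)
  also have "\<dots> \<le> emeasure lborel ?E + emeasure lborel ?U"
    using mE finite_holes by (intro emeasure_subadditive) auto
  also have "emeasure lborel ?U \<le> (\<Sum>p\<in>holes n. emeasure lborel (cball (lattice_point p) ?r))"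
    using finite_holes by (intro emeasure_subadditive_finite) auto
  also have "\<dots> = ennreal (real (card (holes n)) * (pi * ?r\<^sup>2))"
    unfolding cb by (simp add: ennreal_mult ennreal_of_nat_eq_real_of_nat)
  also have "\<dots> \<le> ennreal ((9 * (real n)\<^sup>2) * (pi * ?r\<^sup>2))"
  proof (intro ennreal_leI mult_right_mono)
    show "real (card (holes n)) \<le> 9 * (real n)\<^sup>2"
      using of_nat_mono[OF card_holes_le[OF assms], where 'a=real] by simp
  qed simp
  \<comment> \<open>The total area of the holes stays bounded as n grows.\<close>
  also have "(9 * (real n)\<^sup>2) * (pi * ?r\<^sup>2) = pi * (9/16)"
    using assms by (simp add: field_simps power2_eq_square)
  finally have "ennreal (pi * (real n + 1/2)\<^sup>2) \<le> ennreal (measure lborel ?E + pi * (9/16))"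
    unfolding fin by (simp add: ennreal_plus add_left_mono)
  then have le: "pi * (real n + 1/2)\<^sup>2 \<le> measure lborel ?E + pi * (9/16)"
    by (subst (asm) ennreal_le_iff) auto
  have "1 \<le> real n" using assms by simp
  \<comment> \<open>The extra 1/2 in the radius contributes n + 1/4, which exceeds 9/16.\<close>
  then have "(real n)\<^sup>2 \<le> (real n + 1/2)\<^sup>2 - 9/16" by (simp add: power2_sum)
  then have "1 * (real n)\<^sup>2 \<le> pi * ((real n + 1/2)\<^sup>2 - 9/16)"
    using pi_gt3 by (intro mult_mono) auto
  also have "\<dots> \<le> measure lborel ?E" using le by (simp add: right_diff_distrib)
  finally show ?thesis unfolding fin by (simp add: ennreal_leI)
qed

text \<open>The perimeter is at most 2 pi (n + 1/2 + 9 n / 4) \<le> 2 * 4 * 4 n = 32 n, and the area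
  is at least n^2.\<close>

lemma cheeger_constant_perforated_disc:
  assumes "0 < n"
  shows "cheeger_constant (perforated_disc n) \<le> ennreal (32 / real n)"
proof -
  let ?E = "perforated_competitor n"
  have n: "1 \<le> real n" using assms by simp
  \<comment> \<open>In the index set \<open>None\<close> stands for the outer circle and
    \<open>Some p\<close> for the circle around the hole at \<open>p\<close>.\<close>
  have "hausdorff1 (frontier ?E) \<le> ennreal (2 * pi * (\<Sum>j\<in>insert None (Some ` holes n).
      case_option (real n + 1/2) (\<lambda>_. 1 / (4 * real n)) j))"
  proof (rule hausdorff1_UN_sphere_le[where a="case_option 0 lattice_point"])
    show "frontier ?E \<subseteq> (\<Union>j\<in>insert None (Some ` holes n). sphere (case_option 0 lattice_point j)
        (case_option (real n + 1/2) (\<lambda>_. 1 / (4 * real n)) j))"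
      using perforated_competitor_admissible(5)[OF assms] by simp
  qed (use finite_holes in \<open>auto split: option.split\<close>)
  also have "(\<Sum>j\<in>insert None (Some ` holes n). case_option (real n + 1/2) (\<lambda>_. 1 / (4 * real n)) j)
      = real n + 1/2 + real (card (holes n)) * (1 / (4 * real n))"
    using finite_holes by (subst sum.insert) (auto simp: sum.reindex)
  also have "ennreal (2 * pi * (real n + 1/2 + real (card (holes n)) * (1 / (4 * real n)))) \<le> ennreal (32 * real n)"
  proof (rule ennreal_leI)
    have "real (card (holes n)) \<le> 9 * (real n)\<^sup>2"
      using of_nat_mono[OF card_holes_le[OF assms], where 'a=real] by simp
    then have "real (card (holes n)) * (1 / (4 * real n)) \<le> 9 * (real n)\<^sup>2 * (1 / (4 * real n))"
      by (rule mult_right_mono) simp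
    also have "\<dots> = 9 / 4 * real n" using n by (simp add: power2_eq_square)
    finally have "real n + 1/2 + real (card (holes n)) * (1 / (4 * real n)) \<le> 4 * real n" using n by linarith
    then have "2 * pi * (real n + 1/2 + real (card (holes n)) * (1 / (4 * real n))) \<le> 2 * 4 * (4 * real n)"
      using pi_less_4 by (intro mult_mono) auto
    then show "2 * pi * (real n + 1/2 + real (card (holes n)) * (1 / (4 * real n))) \<le> 32 * real n" by simp
  qed
  finally have P: "hausdorff1 (frontier ?E) \<le> ennreal (32 * real n)" .
  note A = emeasure_perforated_competitor[OF assms]
  have "?E \<noteq> {}" using A n by (auto simp: ennreal_eq_0_iff)
  then have "cheeger_constant (perforated_disc n) \<le> hausdorff1 (frontier ?E) / emeasure lborel ?E"
    using perforated_competitor_admissible[OF assms] by (intro cheeger_constant_le)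
  also have "\<dots> \<le> ennreal (32 * real n) / ennreal ((real n)\<^sup>2)"
    unfolding divide_ennreal_def using P A by (intro mult_mono ennreal_inverse_antimono) auto
  also have "\<dots> = ennreal (32 / real n)"
    using n by (subst divide_ennreal) (auto simp: power2_eq_square)
  finally show ?thesis .
qed

lemma dirichlet_eigenvalue_perforated_disc:
  assumes "0 < n"
  shows "ennreal (3 / (64 * (1 + ln (32 * real n)) * 289)) \<le> dirichlet_eigenvalue (perforated_disc n)"
proof -
  define \<epsilon> where "\<epsilon> = 1 / (8 * real n)"
  have \<epsilon>: "0 < \<epsilon>" "\<epsilon> \<le> 1/8" "4 / \<epsilon> = 32 * real n" using assms by (auto simp: \<epsilon>_def field_simps)
  \<comment> \<open>The true holes, together with lattice points whose \<epsilon>-disc lies beyond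
    the outer circle. The bound n + 5 suffices, as the points chosen below are within 4 of a point
    of norm less than n + 1.\<close>
  let ?I = "{p. norm (lattice_point p) \<le> real (n + 5) \<and>
     (norm (lattice_point p) \<le> real n \<or> real n + 1 + \<epsilon> \<le> norm (lattice_point p))}"
  have "ennreal (3 / (64 * (1 + ln (4 / \<epsilon>)) * real 289)) \<le> dirichlet_eigenvalue (perforated_disc n)"
  proof (rule dirichlet_eigenvalue_many_holes[where z=lattice_point and I="?I"])
    show "finite ?I" by (rule finite_subset[OF _ finite_lattice_disc[of "n + 5"]]) auto
    show "ball (lattice_point p) \<epsilon> \<inter> perforated_disc n = {}" if "p \<in> ?I" for p
    proof -
      have "x \<notin> perforated_disc n" if x: "x \<in> ball (lattice_point p) \<epsilon>" for x
      proof (cases "p \<in> holes n")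
        case True
        then show ?thesis using x by (auto simp: perforated_disc_def \<epsilon>_def intro!: bexI[of _ p])
      next
        case False
        then have "real n + 1 + \<epsilon> \<le> norm (lattice_point p)" using \<open>p \<in> ?I\<close> by (auto simp: holes_def)
        moreover have "norm (lattice_point p) - norm x \<le> dist (lattice_point p) x"
          by (simp add: dist_norm norm_triangle_ineq2)
        ultimately have "norm x > real n + 1" using x by simp
        then show ?thesis by (simp add: perforated_disc_def)
      qed
      then show ?thesis by blast
    qed
    show "\<exists>p\<in>?I. x \<in> cball (lattice_point p) 4" if "x \<in> perforated_disc n" for x
    proof -
      have x: "norm x < real n + 1" using that by (simp add: perforated_disc_def)
      obtain p where p: "dist (lattice_point p) x \<le> 1" using exists_near_lattice_point by blast
      show ?thesis
      proof (cases "norm (lattice_point p) \<le> real n")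
        case True
        then show ?thesis using p by (intro bexI[of _ p]) auto
      next
        case False
        \<comment> \<open>The nearby \<open>p\<close> has norm above n, and its disc may still meet
          the domain. The point \<open>q\<close> has norm above n + 2, safely outside, and is within
          3 + 1 of \<open>x\<close>.\<close>
        obtain q where q: "norm (lattice_point p) + 2 \<le> norm (lattice_point q)"
            "dist (lattice_point q) (lattice_point p) \<le> 3"
          using exists_outer_lattice_point by blast
        have d: "dist (lattice_point q) x \<le> 4"
          using q(2) p dist_triangle[of "lattice_point q" x "lattice_point p"] by linarith
        moreover have "norm (lattice_point q) - norm x \<le> dist (lattice_point q) x"
          by (simp add: dist_norm norm_triangle_ineq2)
        ultimately show ?thesis using q False x \<epsilon> by (intro bexI[of _ q]) auto
      qed
    qed
    show "card {p \<in> ?I. x \<in> ball (lattice_point p) 8} \<le> 289" for x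
      by (rule card_lattice_near_le)
  qed (use \<epsilon> in auto)
  then show ?thesis by (simp add: \<epsilon>(3))
qed

lemma inradius_ball_finite: "inradius (ball 0 R) < \<infinity>"
proof -
  have "inradius (ball 0 R) \<le> ennreal R"
    unfolding inradius_def
  proof (rule SUP_least)
    fix r assume "r \<in> {r. 0 < r \<and> (\<exists>x. ball x r \<subseteq> ball (0::real^2) R)}"
    then obtain x where "0 < r" "ball x r \<subseteq> ball (0::real^2) R" by auto
    then have "r \<le> R" using zero_le_dist[of x 0] unfolding ball_subset_ball_iff by linarith
    then show "ennreal r \<le> ennreal R" by (rule ennreal_leI)
  qed
  then show ?thesis by (simp add: order.strict_trans1)
qed

section \<open>Growth of the supremum\<close>

text \<open>The order of the perforated disc is at most 9 n^2 + 1 \<le> 10 n^2. The factor 10^8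
  rounds up 64 * 289 * 1024 / 3, where 1024 = 32^2 comes from the squared Cheeger bound.\<close>

lemma C_B_lower_bound:
  assumes "0 < n" "10 * n\<^sup>2 \<le> k"
  shows "ennreal ((real n)\<^sup>2 / (10 ^ 8 * (1 + ln (32 * real n)))) \<le> C_B k"
proof -
  have n: "1 \<le> real n" using assms by simp
  have r: "1 / (8 * real n) \<le> 1/4" using n by (simp add: field_simps)
  have "\<exists>j. j \<le> card (holes n) + 1 \<and> multiply_connected j (perforated_disc n)"
    unfolding perforated_disc_def
  proof (rule multiply_connected_perforated_ball)
    show "cball (lattice_point p) (1 / (8 * real n)) \<subseteq> ball 0 (real n + 1)" if "p \<in> holes n" for p
      using hole_subset[OF that r] by (rule order_trans) auto
    have "perforated_competitor n \<noteq> {}" using emeasure_perforated_competitor[OF assms(1)] n by auto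
    moreover have "perforated_competitor n \<subseteq> perforated_disc n"
      using perforated_competitor_admissible(4)[OF assms(1)] closure_subset by blast
    ultimately show "ball 0 (real n + 1) - (\<Union>p\<in>holes n. cball (lattice_point p) (1 / (8 * real n))) \<noteq> {}"
      unfolding perforated_disc_def by blast
  qed (use n r finite_holes disjoint_lattice_cballs in auto)
  then obtain j where j: "j \<le> card (holes n) + 1" "multiply_connected j (perforated_disc n)" by blast
  have "1 \<le> n\<^sup>2" using assms(1) by simp
  then have "j \<le> k" using j(1) card_holes_le[OF assms(1)] assms(2) by linarith
  have inr: "inradius (perforated_disc n) < \<infinity>"
    using inradius_mono[of "perforated_disc n" "ball 0 (real n + 1)"] inradius_ball_finite
    by (auto simp: perforated_disc_def intro: order.strict_trans1)
  have L: "0 \<le> ln (32 * real n)" using n by (intro ln_ge_zero) simp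
  have "(real n)\<^sup>2 / (10 ^ 8 * (1 + ln (32 * real n)))
      \<le> (real n)\<^sup>2 * 3 / ((64 * 289 * 1024) * (1 + ln (32 * real n)))"
    using L n by (simp add: divide_simps) 
  also have "\<dots> = 3 / (64 * (1 + ln (32 * real n)) * 289) / (32 / real n)\<^sup>2"
    using L n by (simp add: power_divide field_simps)
  finally have "ennreal ((real n)\<^sup>2 / (10 ^ 8 * (1 + ln (32 * real n))))
      \<le> ennreal (3 / (64 * (1 + ln (32 * real n)) * 289) / (32 / real n)\<^sup>2)"
    by (rule ennreal_leI)
  also have "\<dots> = ennreal (3 / (64 * (1 + ln (32 * real n)) * 289)) / (ennreal (32 / real n))\<^sup>2"
    using L n by (subst divide_ennreal[symmetric]) (auto simp: ennreal_power)
  also have "\<dots> \<le> dirichlet_eigenvalue (perforated_disc n) / (cheeger_constant (perforated_disc n))\<^sup>2"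
    unfolding divide_ennreal_def[of "dirichlet_eigenvalue _"] divide_ennreal_def[of "ennreal (3 / _)"]
    by (intro mult_mono ennreal_inverse_antimono power_mono cheeger_constant_perforated_disc
        dirichlet_eigenvalue_perforated_disc assms) auto
  also have "\<dots> \<le> C_B j" by (rule C_B_ge[OF j(2) inr])
  also have "\<dots> \<le> C_B k" using monoD[OF mono_C_B \<open>j \<le> k\<close>] .
  finally show ?thesis .
qed

text \<open>Take n as the integer part of sqrt (k / 10). For k \<ge> 10 rounding down at most halves
  it, so 10 n^2 \<le> k \<le> 40 n^2, which turns 10^8 into 40 * 10^8.\<close>

lemma C_B_almost_linear_lower_bound:
  assumes "10 \<le> k"
  shows "ennreal (real k / (4 * 10 ^ 9 * (1 + ln (32 * sqrt (real k))))) \<le> C_B k"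
proof -
  define y where "y = sqrt (real k / 10)"
  define n where "n = nat \<lfloor>y\<rfloor>"
  have y: "1 \<le> y" using assms by (simp add: y_def)
  have "1 \<le> \<lfloor>y\<rfloor>" using y by simp
  then have "0 < n" and "real n = of_int \<lfloor>y\<rfloor>" by (auto simp: n_def)
  moreover have "1 \<le> real n" using \<open>0 < n\<close> by simp
  ultimately have n: "0 < n" "real n \<le> y" "y \<le> 2 * real n"
    using floor_correct[of y] by linarith+
  have y2: "y\<^sup>2 = real k / 10" by (simp add: y_def)
  have "(real n)\<^sup>2 \<le> y\<^sup>2" using n by (intro power_mono) auto
  then have "real (10 * n\<^sup>2) \<le> real k" using y2 by simp
  then have "10 * n\<^sup>2 \<le> k" by (simp only: of_nat_le_iff)
  have "y\<^sup>2 \<le> (2 * real n)\<^sup>2" using n y by (intro power_mono) auto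
  then have k: "real k \<le> 40 * (real n)\<^sup>2" using y2 by (simp add: power_mult_distrib)
  have L: "0 \<le> ln (32 * real n)" using n(1) by (intro ln_ge_zero) auto
  have "y \<le> sqrt (real k)" by (simp add: y_def)
  then have "ln (32 * real n) \<le> ln (32 * sqrt (real k))"
    using n assms by (subst ln_le_cancel_iff) auto
  then have "real k / (4 * 10 ^ 9 * (1 + ln (32 * sqrt (real k)))) \<le> 40 * (real n)\<^sup>2 / (4 * 10 ^ 9 * (1 + ln (32 * real n)))"
    using L k by (intro frac_le) auto
  also have "\<dots> = 40 * (real n)\<^sup>2 / (40 * (10 ^ 8 * (1 + ln (32 * real n))))" by simp
  also have "\<dots> = (real n)\<^sup>2 / (10 ^ 8 * (1 + ln (32 * real n)))"
    by (rule mult_divide_mult_cancel_left) simp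
  finally show ?thesis
    using C_B_lower_bound[OF n(1) \<open>10 * n\<^sup>2 \<le> k\<close>] ennreal_leI order_trans by blast
qed

lemma C_B_div_powr_tendsto:
  assumes "0 < \<alpha>" "\<alpha> < 1"
  shows "(\<lambda>k. C_B k / ennreal (real k powr \<alpha>)) \<longlonglongrightarrow> \<infinity>"
proof -
  let ?f = "\<lambda>k. real k / (4 * 10 ^ 9 * (1 + ln (32 * sqrt (real k)))) / real k powr \<alpha>"
  have "filterlim ?f at_top sequentially" using assms by real_asymp
  then have lim: "(\<lambda>k. ennreal (?f k)) \<longlonglongrightarrow> top"
    by (subst ennreal_tendsto_top_eq_at_top)
  have ev: "eventually (\<lambda>k. ennreal (?f k) \<le> C_B k / ennreal (real k powr \<alpha>)) sequentially"
    using eventually_ge_at_top[of 10]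
  proof eventually_elim
    case (elim k)
    have "1 \<le> sqrt (real k)" using elim by simp
    then have "0 \<le> ln (32 * sqrt (real k))" by (intro ln_ge_zero) linarith
    then have "ennreal (?f k) = ennreal (real k / (4 * 10 ^ 9 * (1 + ln (32 * sqrt (real k))))) / ennreal (real k powr \<alpha>)"
      using elim by (subst divide_ennreal) auto
    also have "\<dots> \<le> C_B k / ennreal (real k powr \<alpha>)"
      by (intro divide_right_mono_ennreal C_B_almost_linear_lower_bound elim)
    finally show ?case .
  qed
  show ?thesis
    using tendsto_sandwich[OF ev _ lim tendsto_const[of top]] by (simp add: infinity_ennreal_def)
qed

theorem proposition5p6:
  shows "mono_on {1..} C_B \<and>
    (\<forall>\<alpha>::real. 0 < \<alpha> \<and> \<alpha> < 1 \<longrightarrow>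
      ((\<lambda>k. C_B k / ennreal (real k powr \<alpha>)) \<longlonglongrightarrow> \<infinity>))"
  using mono_on_subset[OF mono_C_B subset_UNIV] C_B_div_powr_tendsto by blast

end
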